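(* Let $\{e_i\}_{i\in I}$ be an orthonormal system in a Hilbert module $M$ over a unital $C^*$-algebra $A$. Consider the conditions: (c1) $M$ is the norm closure of the $A$-linear span of $\{e_i : i\in I\}$; (c2) for any $x\in M$ there are elements $a_i\in A$ ($i\in I$) such that $x=\sum_{i\in I}e_ia_i$, with convergence in norm; (c3) for any $x\in M$ the series $\sum_{i\in I}\bigl(2\langle x,e_i\rangle\langle e_i,x\rangle-\langle x,e_i\rangle\langle e_i,e_i\rangle\langle e_i,x\rangle\bigr)$ converges in norm to $\langle x,x\rangle$; (c4) there is no non-zero vector $x\in M$ such that $\langle e_i,x\rangle=0$ for all $i\in I$. Then the conditions (c1), (c2), (c3) are equivalent, and each of them is strictly stronger than (c4): each of (c1), (c2), (c3) implies (c4), whereas (c4) does not in general imply any of them, i.e. there exist a unital $C^*$-algebra, a Hilbert module over it and an orthonormal system in that module which satisfies (c4) but none of (c1), (c2), (c3).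
   Context: A Hilbert $A$-module is a right $A$-module $M$ (compatibly a complex vector space) with an $A$-valued inner product $\langle\cdot,\cdot\rangle$ that is linear in the second variable and satisfies $\langle x,ya\rangle=\langle x,y\rangle a$, $\langle x,y\rangle^*=\langle y,x\rangle$, $\langle x,x\rangle\ge 0$, and $\langle x,x\rangle=0$ only if $x=0$, and which is complete in the norm $\|x\|=\|\langle x,x\rangle\|^{1/2}$. A collection $\{e_i\}_{i\in I}$ of vectors of $M$, indexed by some set $I$, is called orthonormal ($A$ being unital) if $\langle e_i,e_j\rangle=0$ whenever $i\neq j$ and $\langle e_i,e_i\rangle=1$ for all $i\in I$. Sums over $I$ denote norm limits of the finite sums over finite subsets $F$ of $I$, directed by inclusion. *)

theory Defs
  imports Complex_Main "HOL-Algebra.Module" "HOL-Library.Nonpos_Ints"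
begin

text \<open>
  Algebras and modules are carrier-based records in the style of HOL-Algebra, so that the
  existence of an algebra together with a module over it can be expressed by quantifying over
  records. The norms are functions on these records, and all topological notions are phrased
  through the norm of a difference.
\<close>

definition complex_field :: "complex ring" where
  "complex_field = \<lparr>carrier = UNIV, mult = (*), one = 1, zero = 0, add = (+)\<rparr>"

definition norm_complete :: "('x, 'r) ring_scheme \<Rightarrow> ('x \<Rightarrow> real) \<Rightarrow> bool" where
  "norm_complete G nrm \<longleftrightarrow>
     (\<forall>u :: nat \<Rightarrow> 'x. range u \<subseteq> carrier G \<longrightarrow>
        (\<forall>\<epsilon>>0. \<exists>N. \<forall>m\<ge>N. \<forall>n\<ge>N. nrm (u m \<ominus>\<^bsub>G\<^esub> u n) < \<epsilon>) \<longrightarrow>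
        (\<exists>l\<in>carrier G. (\<lambda>n. nrm (u n \<ominus>\<^bsub>G\<^esub> l)) \<longlonglongrightarrow> 0))"

definition norm_closure :: "('x, 'r) ring_scheme \<Rightarrow> ('x \<Rightarrow> real) \<Rightarrow> 'x set \<Rightarrow> 'x set" where
  "norm_closure G nrm S = {x \<in> carrier G. \<forall>\<epsilon>>0. \<exists>y\<in>S. nrm (x \<ominus>\<^bsub>G\<^esub> y) < \<epsilon>}"

definition has_norm_sum ::
    "('x, 'r) ring_scheme \<Rightarrow> ('x \<Rightarrow> real) \<Rightarrow> ('i \<Rightarrow> 'x) \<Rightarrow> 'i set \<Rightarrow> 'x \<Rightarrow> bool" where
  "has_norm_sum G nrm f I s \<longleftrightarrow>
     ((\<lambda>F. nrm (finsum G f F \<ominus>\<^bsub>G\<^esub> s)) \<longlongrightarrow> 0) (finite_subsets_at_top I)"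


section \<open>Unital C*-algebras\<close>

record 'a star_algebra = "(complex, 'a) module" +
  star :: "'a \<Rightarrow> 'a"
  anorm :: "'a \<Rightarrow> real"

text \<open>The zero algebra is not excluded.\<close>

locale unital_cstar_algebra =
  fixes A :: "('a, 'r) star_algebra_scheme" (structure)
  assumes ring: "Ring.ring A"
    and vector_space: "Module.module complex_field A"
    and smult_mult_left: "\<lbrakk>a \<in> carrier A; b \<in> carrier A\<rbrakk> \<Longrightarrow> (c \<odot> a) \<otimes> b = c \<odot> (a \<otimes> b)"
    and smult_mult_right: "\<lbrakk>a \<in> carrier A; b \<in> carrier A\<rbrakk> \<Longrightarrow> a \<otimes> (c \<odot> b) = c \<odot> (a \<otimes> b)"
    and star_closed: "a \<in> carrier A \<Longrightarrow> star A a \<in> carrier A"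
    and star_star: "a \<in> carrier A \<Longrightarrow> star A (star A a) = a"
    and star_add: "\<lbrakk>a \<in> carrier A; b \<in> carrier A\<rbrakk> \<Longrightarrow> star A (a \<oplus> b) = star A a \<oplus> star A b"
    and star_smult: "a \<in> carrier A \<Longrightarrow> star A (c \<odot> a) = cnj c \<odot> star A a"
    and star_mult: "\<lbrakk>a \<in> carrier A; b \<in> carrier A\<rbrakk> \<Longrightarrow> star A (a \<otimes> b) = star A b \<otimes> star A a"
    and anorm_nonneg: "a \<in> carrier A \<Longrightarrow> 0 \<le> anorm A a"
    and anorm_eq_0_iff: "a \<in> carrier A \<Longrightarrow> anorm A a = 0 \<longleftrightarrow> a = \<zero>"
    and anorm_triangle:
      "\<lbrakk>a \<in> carrier A; b \<in> carrier A\<rbrakk> \<Longrightarrow> anorm A (a \<oplus> b) \<le> anorm A a + anorm A b"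
    and anorm_smult: "a \<in> carrier A \<Longrightarrow> anorm A (c \<odot> a) = cmod c * anorm A a"
    and anorm_mult:
      "\<lbrakk>a \<in> carrier A; b \<in> carrier A\<rbrakk> \<Longrightarrow> anorm A (a \<otimes> b) \<le> anorm A a * anorm A b"
    and cstar_identity: "a \<in> carrier A \<Longrightarrow> anorm A (star A a \<otimes> a) = (anorm A a)\<^sup>2"
    and complete: "norm_complete A (anorm A)"

definition spectrum :: "('a, 'r) star_algebra_scheme \<Rightarrow> 'a \<Rightarrow> complex set" where
  "spectrum A a = {c. c \<odot>\<^bsub>A\<^esub> \<one>\<^bsub>A\<^esub> \<ominus>\<^bsub>A\<^esub> a \<notin> Units A}"

definition positive :: "('a, 'r) star_algebra_scheme \<Rightarrow> 'a \<Rightarrow> bool" where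
  "positive A a \<longleftrightarrow> a \<in> carrier A \<and> star A a = a \<and> spectrum A a \<subseteq> \<real>\<^sub>\<ge>\<^sub>0"


section \<open>Hilbert modules\<close>

record ('m, 'a) inner_module = "(complex, 'm) module" +
  ract :: "'m \<Rightarrow> 'a \<Rightarrow> 'm"
  inprod :: "'m \<Rightarrow> 'm \<Rightarrow> 'a"

definition hnorm ::
    "('a, 'r) star_algebra_scheme \<Rightarrow> ('m, 'a, 's) inner_module_scheme \<Rightarrow> 'm \<Rightarrow> real" where
  "hnorm A M x = sqrt (anorm A (inprod M x x))"

text \<open>
  The fields \<open>mult\<close> and \<open>one\<close> that a module record inherits from ring records carry no meaning
  for \<open>M\<close>, as usual in HOL-Algebra.
\<close>

locale hilbert_module = unital_cstar_algebra A
  for A :: "('a, 'r) star_algebra_scheme" +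
  fixes M :: "('m, 'a, 's) inner_module_scheme"
  assumes M_vector_space: "Module.module complex_field M"
    and ract_closed: "\<lbrakk>x \<in> carrier M; a \<in> carrier A\<rbrakk> \<Longrightarrow> ract M x a \<in> carrier M"
    and ract_add_left: "\<lbrakk>x \<in> carrier M; y \<in> carrier M; a \<in> carrier A\<rbrakk> \<Longrightarrow>
      ract M (x \<oplus>\<^bsub>M\<^esub> y) a = ract M x a \<oplus>\<^bsub>M\<^esub> ract M y a"
    and ract_add_right: "\<lbrakk>x \<in> carrier M; a \<in> carrier A; b \<in> carrier A\<rbrakk> \<Longrightarrow>
      ract M x (a \<oplus>\<^bsub>A\<^esub> b) = ract M x a \<oplus>\<^bsub>M\<^esub> ract M x b"
    and ract_mult: "\<lbrakk>x \<in> carrier M; a \<in> carrier A; b \<in> carrier A\<rbrakk> \<Longrightarrow>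
      ract M x (a \<otimes>\<^bsub>A\<^esub> b) = ract M (ract M x a) b"
    and ract_one: "x \<in> carrier M \<Longrightarrow> ract M x \<one>\<^bsub>A\<^esub> = x"
    and ract_smult_left: "\<lbrakk>x \<in> carrier M; a \<in> carrier A\<rbrakk> \<Longrightarrow>
      ract M (c \<odot>\<^bsub>M\<^esub> x) a = c \<odot>\<^bsub>M\<^esub> ract M x a"
    and ract_smult_right: "\<lbrakk>x \<in> carrier M; a \<in> carrier A\<rbrakk> \<Longrightarrow>
      ract M x (c \<odot>\<^bsub>A\<^esub> a) = c \<odot>\<^bsub>M\<^esub> ract M x a"
    and inprod_closed: "\<lbrakk>x \<in> carrier M; y \<in> carrier M\<rbrakk> \<Longrightarrow> inprod M x y \<in> carrier A"
    and inprod_add_right: "\<lbrakk>x \<in> carrier M; y \<in> carrier M; z \<in> carrier M\<rbrakk> \<Longrightarrow>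
      inprod M x (y \<oplus>\<^bsub>M\<^esub> z) = inprod M x y \<oplus>\<^bsub>A\<^esub> inprod M x z"
    and inprod_smult_right: "\<lbrakk>x \<in> carrier M; y \<in> carrier M\<rbrakk> \<Longrightarrow>
      inprod M x (c \<odot>\<^bsub>M\<^esub> y) = c \<odot>\<^bsub>A\<^esub> inprod M x y"
    and inprod_ract_right: "\<lbrakk>x \<in> carrier M; y \<in> carrier M; a \<in> carrier A\<rbrakk> \<Longrightarrow>
      inprod M x (ract M y a) = inprod M x y \<otimes>\<^bsub>A\<^esub> a"
    and star_inprod: "\<lbrakk>x \<in> carrier M; y \<in> carrier M\<rbrakk> \<Longrightarrow>
      star A (inprod M x y) = inprod M y x"
    and inprod_positive: "x \<in> carrier M \<Longrightarrow> positive A (inprod M x x)"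
    and inprod_definite: "\<lbrakk>x \<in> carrier M; inprod M x x = \<zero>\<^bsub>A\<^esub>\<rbrakk> \<Longrightarrow> x = \<zero>\<^bsub>M\<^esub>"
    and M_complete: "norm_complete M (hnorm A M)"

definition orthonormal_system ::
    "('a, 'r) star_algebra_scheme \<Rightarrow> ('m, 'a, 's) inner_module_scheme
      \<Rightarrow> 'i set \<Rightarrow> ('i \<Rightarrow> 'm) \<Rightarrow> bool" where
  "orthonormal_system A M I e \<longleftrightarrow>
     (\<forall>i\<in>I. e i \<in> carrier M) \<and>
     (\<forall>i\<in>I. \<forall>j\<in>I. i \<noteq> j \<longrightarrow> inprod M (e i) (e j) = \<zero>\<^bsub>A\<^esub>) \<and>
     (\<forall>i\<in>I. inprod M (e i) (e i) = \<one>\<^bsub>A\<^esub>)"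

definition A_span ::
    "('a, 'r) star_algebra_scheme \<Rightarrow> ('m, 'a, 's) inner_module_scheme
      \<Rightarrow> 'i set \<Rightarrow> ('i \<Rightarrow> 'm) \<Rightarrow> 'm set" where
  "A_span A M I e =
     {finsum M (\<lambda>i. ract M (e i) (a i)) F | F a. finite F \<and> F \<subseteq> I \<and> a \<in> I \<rightarrow> carrier A}"

definition cond_c1 ::
    "('a, 'r) star_algebra_scheme \<Rightarrow> ('m, 'a, 's) inner_module_scheme
      \<Rightarrow> 'i set \<Rightarrow> ('i \<Rightarrow> 'm) \<Rightarrow> bool" where
  "cond_c1 A M I e \<longleftrightarrow> carrier M = norm_closure M (hnorm A M) (A_span A M I e)"

definition cond_c2 ::
    "('a, 'r) star_algebra_scheme \<Rightarrow> ('m, 'a, 's) inner_module_scheme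
      \<Rightarrow> 'i set \<Rightarrow> ('i \<Rightarrow> 'm) \<Rightarrow> bool" where
  "cond_c2 A M I e \<longleftrightarrow>
     (\<forall>x\<in>carrier M. \<exists>a\<in>I \<rightarrow> carrier A.
        has_norm_sum M (hnorm A M) (\<lambda>i. ract M (e i) (a i)) I x)"

definition cond_c3 ::
    "('a, 'r) star_algebra_scheme \<Rightarrow> ('m, 'a, 's) inner_module_scheme
      \<Rightarrow> 'i set \<Rightarrow> ('i \<Rightarrow> 'm) \<Rightarrow> bool" where
  "cond_c3 A M I e \<longleftrightarrow>
     (\<forall>x\<in>carrier M.
        has_norm_sum A (anorm A)
          (\<lambda>i. (2 \<odot>\<^bsub>A\<^esub> (inprod M x (e i) \<otimes>\<^bsub>A\<^esub> inprod M (e i) x)) \<ominus>\<^bsub>A\<^esub>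
               (inprod M x (e i) \<otimes>\<^bsub>A\<^esub> inprod M (e i) (e i) \<otimes>\<^bsub>A\<^esub> inprod M (e i) x))
          I (inprod M x x))"

definition cond_c4 ::
    "('a, 'r) star_algebra_scheme \<Rightarrow> ('m, 'a, 's) inner_module_scheme
      \<Rightarrow> 'i set \<Rightarrow> ('i \<Rightarrow> 'm) \<Rightarrow> bool" where
  "cond_c4 A M I e \<longleftrightarrow>
     \<not> (\<exists>x\<in>carrier M. x \<noteq> \<zero>\<^bsub>M\<^esub> \<and> (\<forall>i\<in>I. inprod M (e i) x = \<zero>\<^bsub>A\<^esub>))"

end

theory Submission
  imports Defs "HOL-Analysis.Complex_Analysis_Basics" "HOL-Analysis.Urysohn"
begin

text \<open>
  For a finite set \<open>F\<close> of indices let \<open>P\<^sub>F x = \<Sum>\<^sub>i\<^sub>\<in>\<^sub>F e\<^sub>i \<langle>e\<^sub>i, x\<rangle>\<close>. Orthonormality makes \<open>x - P\<^sub>F x\<close> orthogonal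
  to the \<open>e\<^sub>i\<close> with \<open>i \<in> F\<close>, which gives Bessel's identity
  \<open>\<langle>x - P\<^sub>F x, x - P\<^sub>F x\<rangle> = \<langle>x, x\<rangle> - \<Sum>\<^sub>i\<^sub>\<in>\<^sub>F \<langle>x, e\<^sub>i\<rangle> \<langle>e\<^sub>i, x\<rangle>\<close>. The series in the third condition has the same
  summands, so this condition says that \<open>P\<^sub>F x\<close> tends to \<open>x\<close> for every \<open>x\<close> (lemma \<open>cond_c3_iff\<close>).
  Hence it implies the second condition, with coefficients \<open>\<langle>e\<^sub>i, x\<rangle>\<close>, and the fourth one, because \<open>P\<^sub>F x = 0\<close>
  whenever all these coefficients vanish. The second condition implies the first one by definition.
  The first one implies the third one because \<open>P\<^sub>F x\<close> is a best approximation of \<open>x\<close> in the span of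
  \<open>F\<close> (lemma \<open>residual_le_approximation\<close>): for \<open>y\<close> in this span, \<open>x - y\<close> is the sum of the orthogonal
  vectors \<open>x - P\<^sub>F x\<close> and \<open>P\<^sub>F x - y\<close>.

  What remains is \<open>\<parallel>u\<parallel> \<le> \<parallel>u + v\<parallel>\<close> for orthogonal \<open>u\<close> and \<open>v\<close>, that is, \<open>\<parallel>a\<parallel> \<le> \<parallel>a + b\<parallel>\<close> for
  \<open>a = \<langle>u, u\<rangle>\<close> and \<open>b = \<langle>v, v\<rangle>\<close> (lemma \<open>hnorm_le_hnorm_add\<close>). Positivity of \<open>a\<close> and \<open>b\<close> is a statement about
  their spectra, so a link between spectrum and norm is needed. Two facts provide it. If \<open>l > \<parallel>a + b\<parallel>\<close>,
  then \<open>l - a\<close> is invertible (lemma \<open>Units_minus_inprod\<close>): \<open>l - (a + b)\<close> is a multiple of the square of an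
  invertible self-adjoint element, by which \<open>l - a\<close> can be conjugated into \<open>l\<close> plus a positive element.
  On the other hand, \<open>\<parallel>a\<parallel>\<close> or \<open>-\<parallel>a\<parallel>\<close> is in the spectrum of a self-adjoint element \<open>a \<noteq> 0\<close> (lemma
  \<open>anorm_square_not_unit\<close>): otherwise \<open>t - a\<^sup>2\<close> would have a self-adjoint square root \<open>g\<close> commuting
  with \<open>a\<close> for some \<open>t < \<parallel>a\<parallel>\<^sup>2\<close>, and \<open>a\<close> would be the real part of the element \<open>a + \<i> g\<close> of norm at most
  \<open>\<surd>t\<close>. Positivity excludes \<open>-\<parallel>a\<parallel>\<close>, so \<open>\<parallel>a\<parallel>\<close> is a spectral value, and by the first fact it is at most
  \<open>\<parallel>a + b\<parallel>\<close>. The square roots come from a fixed point iteration (lemma \<open>square_root_one_minus\<close>).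

  For the strictness let \<open>A = \<ell>\<^sup>\<infinity>\<close>, let \<open>M\<close> be the module of bounded sequences \<open>x\<^sub>0, x\<^sub>1, \<dots>\<close> of vectors in
  \<open>\<ell>\<^sup>2\<close> with the termwise inner product, and let \<open>e\<^sub>j\<close> be the constant sequence whose terms are the \<open>j\<close>-th
  unit vector. Then \<open>\<langle>e\<^sub>j, x\<rangle>\<close> is the sequence of \<open>j\<close>-th coordinates of \<open>x\<close>, so \<open>x = 0\<close> if all of them
  vanish. But the sequence whose \<open>n\<close>-th term is the \<open>n\<close>-th unit vector has distance at least \<open>1\<close> from every
  combination of finitely many \<open>e\<^sub>j\<close>.
\<close>

section \<open>Norm and spectrum in unital C*-algebras\<close>

context unital_cstar_algebra
begin

sublocale ring A
  by (rule ring)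

lemma smult_closed [simp, intro]: "a \<in> carrier A \<Longrightarrow> c \<odot> a \<in> carrier A"
  using module.smult_closed[OF vector_space, of c a] by (simp add: complex_field_def)

lemma smult_add_left: "a \<in> carrier A \<Longrightarrow> (c + d) \<odot> a = c \<odot> a \<oplus> d \<odot> a"
  using module.smult_l_distr[OF vector_space, of c d a] by (simp add: complex_field_def)

lemma smult_add_right:
  "a \<in> carrier A \<Longrightarrow> b \<in> carrier A \<Longrightarrow> c \<odot> (a \<oplus> b) = c \<odot> a \<oplus> c \<odot> b"
  using module.smult_r_distr[OF vector_space, of c a b] by (simp add: complex_field_def)

lemma smult_smult [simp]: "a \<in> carrier A \<Longrightarrow> c \<odot> (d \<odot> a) = (c * d) \<odot> a"
  using module.smult_assoc1[OF vector_space, of c d a] by (simp add: complex_field_def)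

lemma smult_1 [simp]: "a \<in> carrier A \<Longrightarrow> 1 \<odot> a = a"
  using module.smult_one[OF vector_space, of a] by (simp add: complex_field_def)

lemma smult_0 [simp]: "a \<in> carrier A \<Longrightarrow> 0 \<odot> a = \<zero>"
  using module.smult_l_null[OF vector_space, of a] by (simp add: complex_field_def)

lemma smult_zero [simp]: "c \<odot> \<zero> = \<zero>"
  using module.smult_r_null[OF vector_space, of c] by (simp add: complex_field_def)

lemma uminus_eq_smult: "a \<in> carrier A \<Longrightarrow> \<ominus> a = (-1) \<odot> a"
  by (rule minus_equality) (use smult_add_left[of a "-1" 1] in auto)

lemma minus_eq_zero_iff:
  assumes "a \<in> carrier A" "b \<in> carrier A"
  shows "a \<ominus> b = \<zero> \<longleftrightarrow> a = b"
proof
  have "a = (a \<ominus> b) \<oplus> b"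
    using assms by algebra
  then show "a = b" if "a \<ominus> b = \<zero>"
    using that assms by simp
qed (use assms in \<open>simp add: minus_eq r_neg\<close>)

lemma add_uminus_cancel:
  assumes "a \<in> carrier A" "b \<in> carrier A"
  shows "a \<oplus> ((-1) \<odot> a \<oplus> b) = b"
  using r_neg2[OF assms] assms by (simp add: uminus_eq_smult)

lemma add_smult_cancel:
  assumes "a \<in> carrier A" "b \<in> carrier A"
  shows "c \<odot> a \<oplus> ((- c) \<odot> a \<oplus> b) = b" "(- c) \<odot> a \<oplus> (c \<odot> a \<oplus> b) = b"
  using r_neg2[of "c \<odot> a" b] r_neg1[of "c \<odot> a" b] assms by (simp_all add: uminus_eq_smult)

lemma smult_uminus: "a \<in> carrier A \<Longrightarrow> c \<odot> (\<ominus> a) = (- c) \<odot> a"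
  by (simp add: uminus_eq_smult)

lemmas algebra_rules = minus_eq uminus_eq_smult smult_add_left smult_add_right
  smult_mult_left smult_mult_right l_distr r_distr m_assoc a_assoc

declare star_closed [simp, intro] star_star [simp]

lemma star_zero [simp]: "star A \<zero> = \<zero>"
  using star_smult[of \<zero> 0] by simp

lemma star_one [simp]: "star A \<one> = \<one>"
  by (metis l_one one_closed star_closed star_mult star_star)

lemma star_uminus: "a \<in> carrier A \<Longrightarrow> star A (\<ominus> a) = \<ominus> star A a"
  by (simp add: uminus_eq_smult star_smult)

lemma star_minus:
  "a \<in> carrier A \<Longrightarrow> b \<in> carrier A \<Longrightarrow> star A (a \<ominus> b) = star A a \<ominus> star A b"
  by (simp add: minus_eq star_add star_uminus)

lemma anorm_zero [simp]: "anorm A \<zero> = 0"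
  by (simp add: anorm_eq_0_iff)

lemma anorm_uminus [simp]: "a \<in> carrier A \<Longrightarrow> anorm A (\<ominus> a) = anorm A a"
  by (simp add: uminus_eq_smult anorm_smult)

lemma anorm_minus_commute:
  "a \<in> carrier A \<Longrightarrow> b \<in> carrier A \<Longrightarrow> anorm A (a \<ominus> b) = anorm A (b \<ominus> a)"
  using anorm_uminus[of "a \<ominus> b"] by (simp add: minus_eq minus_add a_comm)

lemma anorm_triangle_minus:
  assumes "a \<in> carrier A" "b \<in> carrier A" "c \<in> carrier A"
  shows "anorm A (a \<ominus> c) \<le> anorm A (a \<ominus> b) + anorm A (b \<ominus> c)"
proof -
  have "a \<ominus> c = (a \<ominus> b) \<oplus> (b \<ominus> c)"
    using assms by algebra
  then show ?thesis
    using assms by (simp add: anorm_triangle)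
qed

lemma anorm_star [simp]:
  assumes "a \<in> carrier A"
  shows "anorm A (star A a) = anorm A a"
proof -
  have "anorm A b \<le> anorm A (star A b)" if b: "b \<in> carrier A" for b
  proof (cases "anorm A b = 0")
    case False
    have "(anorm A b)\<^sup>2 \<le> anorm A (star A b) * anorm A b"
      using b anorm_mult[of "star A b" b] by (simp flip: cstar_identity)
    then show ?thesis
      using False anorm_nonneg[OF b] by (simp add: power2_eq_square)
  qed (use anorm_nonneg[OF star_closed[OF b]] in simp)
  from this[of a] this[of "star A a"] assms show ?thesis
    by auto
qed

lemma anorm_one_le: "anorm A \<one> \<le> 1"
proof -
  have "(anorm A \<one>)\<^sup>2 = anorm A \<one>"
    using cstar_identity[of \<one>] by simp
  then show ?thesis
    by (auto simp: power2_eq_square)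
qed

definition norm_ball :: "real \<Rightarrow> 'a set" where
  "norm_ball \<rho> = {z \<in> carrier A. anorm A z \<le> \<rho>}"

text \<open>
  Completeness enters the proofs about \<open>A\<close> only through Banach's fixed point theorem on closed
  balls around the origin.
\<close>
lemma contraction_fixed_point:
  assumes "0 \<le> \<rho>" and k: "k < 1"
    and f: "f \<in> norm_ball \<rho> \<rightarrow> norm_ball \<rho>"
    and contr: "\<And>z w. z \<in> norm_ball \<rho> \<Longrightarrow> w \<in> norm_ball \<rho> \<Longrightarrow>
      anorm A (f z \<ominus> f w) \<le> k * anorm A (z \<ominus> w)"
  shows "\<exists>!z. z \<in> norm_ball \<rho> \<and> f z = z"
proof -
  define d where "d = (\<lambda>a b. if a \<in> carrier A \<and> b \<in> carrier A then anorm A (a \<ominus> b) else 0)"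
  have d_eq: "d a b = anorm A (a \<ominus> b)" if "a \<in> norm_ball \<rho>" "b \<in> norm_ball \<rho>" for a b
    using that by (simp add: d_def norm_ball_def)
  interpret B: Metric_space "norm_ball \<rho>" d
  proof
    show "0 \<le> d a b" "d a b = d b a" for a b
      by (auto simp: d_def anorm_nonneg intro: anorm_minus_commute)
  next
    fix a b c assume "a \<in> norm_ball \<rho>" "b \<in> norm_ball \<rho>" "c \<in> norm_ball \<rho>"
    then show "d a c \<le> d a b + d b c"
      using anorm_triangle_minus by (simp add: d_eq) (simp add: norm_ball_def)
  qed (auto simp: d_def norm_ball_def anorm_eq_0_iff minus_eq_zero_iff)
  have "B.mcomplete"
    unfolding B.mcomplete_def
  proof (intro allI impI)
    fix u assume u: "B.MCauchy u"
    then have ub: "u n \<in> norm_ball \<rho>" for n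
      by (auto simp: B.MCauchy_def)
    then have uc: "u n \<in> carrier A" for n
      by (auto simp: norm_ball_def)
    have "\<forall>\<epsilon>>0. \<exists>N. \<forall>m\<ge>N. \<forall>n\<ge>N. anorm A (u m \<ominus> u n) < \<epsilon>"
      using u by (force simp: B.MCauchy_def d_eq ub)
    then obtain l where l: "l \<in> carrier A" "(\<lambda>n. anorm A (u n \<ominus> l)) \<longlonglongrightarrow> 0"
      using complete uc unfolding norm_complete_def by blast
    have "anorm A l \<le> \<rho> + anorm A (u n \<ominus> l)" for n
    proof -
      have "anorm A l \<le> anorm A (u n) + anorm A (\<ominus> (u n \<ominus> l))"
        using anorm_triangle[of "u n" "\<ominus> (u n \<ominus> l)"] l(1) uc[of n]
        by (simp add: minus_eq minus_add minus_minus r_neg2)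
      then show ?thesis
        using ub[of n] l(1) uc[of n] by (simp add: norm_ball_def)
    qed
    then have "anorm A l \<le> \<rho> + 0"
      by (intro LIMSEQ_le_const[OF tendsto_add[OF tendsto_const l(2)]]) auto
    then have "l \<in> norm_ball \<rho>"
      using l(1) by (simp add: norm_ball_def)
    then show "\<exists>l. limitin B.mtopology u l sequentially"
      using l ub by (auto simp: B.limitin_metric_dist_null d_eq)
  qed
  moreover have "\<zero> \<in> norm_ball \<rho>"
    using assms(1) by (simp add: norm_ball_def)
  moreover have contr_d: "d (f z) (f w) \<le> k * d z w" if "z \<in> norm_ball \<rho>" "w \<in> norm_ball \<rho>" for z w
    using contr[OF that] that f by (simp add: d_eq Pi_iff)
  ultimately obtain z where z: "z \<in> norm_ball \<rho>" "f z = z"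
    using B.Banach_fixedpoint_thm[OF _ _ f k] by blast
  moreover have "w = z" if "w \<in> norm_ball \<rho>" "f w = w" for w
    using B.contraction_imp_unique_fixpoint[OF that(2) z(2) f k contr_d that(1) z(1)] .
  ultimately show ?thesis
    by blast
qed

lemma anorm_minus_le:
  "a \<in> carrier A \<Longrightarrow> b \<in> carrier A \<Longrightarrow> anorm A (a \<ominus> b) \<le> anorm A a + anorm A b"
  using anorm_triangle[of a "\<ominus> b"] by (simp add: minus_eq)

text \<open>
  A right inverse \<open>w\<close> of \<open>1 - s\<close> is a fixed point of \<open>w \<mapsto> 1 + s w\<close>, which is a contraction with
  factor \<open>\<parallel>s\<parallel>\<close>.
\<close>
lemma neumann_right_inverse:
  assumes s: "s \<in> carrier A" and s1: "anorm A s < 1"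
  obtains w where "w \<in> carrier A" "(\<one> \<ominus> s) \<otimes> w = \<one>"
proof -
  define \<rho> where "\<rho> = 1 / (1 - anorm A s)"
  have \<rho>: "0 \<le> \<rho>" "1 + anorm A s * \<rho> = \<rho>"
    using s1 by (simp_all add: \<rho>_def field_simps)
  have maps: "(\<lambda>w. \<one> \<oplus> s \<otimes> w) \<in> norm_ball \<rho> \<rightarrow> norm_ball \<rho>"
  proof
    fix w assume "w \<in> norm_ball \<rho>"
    then have w: "w \<in> carrier A" "anorm A w \<le> \<rho>"
      by (auto simp: norm_ball_def)
    have "anorm A (\<one> \<oplus> s \<otimes> w) \<le> 1 + anorm A s * \<rho>"
      using anorm_triangle[of \<one> "s \<otimes> w"] anorm_one_le anorm_mult[OF s w(1)]
        mult_left_mono[OF w(2) anorm_nonneg[OF s]] s w(1) by simp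
    then show "\<one> \<oplus> s \<otimes> w \<in> norm_ball \<rho>"
      using \<rho>(2) s w(1) by (simp add: norm_ball_def)
  qed
  have contr: "anorm A ((\<one> \<oplus> s \<otimes> z) \<ominus> (\<one> \<oplus> s \<otimes> w)) \<le> anorm A s * anorm A (z \<ominus> w)"
    if "z \<in> norm_ball \<rho>" "w \<in> norm_ball \<rho>" for z w
  proof -
    have zw: "z \<in> carrier A" "w \<in> carrier A"
      using that by (auto simp: norm_ball_def)
    have "(\<one> \<oplus> s \<otimes> z) \<ominus> (\<one> \<oplus> s \<otimes> w) = s \<otimes> (z \<ominus> w)"
      using s zw one_closed by algebra
    then show ?thesis
      using anorm_mult s zw by simp
  qed
  obtain w where w: "w \<in> norm_ball \<rho>" "\<one> \<oplus> s \<otimes> w = w"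
    using contraction_fixed_point[OF \<rho>(1) s1 maps contr] by blast
  then have wc: "w \<in> carrier A"
    by (simp add: norm_ball_def)
  have "(\<one> \<ominus> s) \<otimes> w = w \<ominus> s \<otimes> w"
    using s wc by (simp add: minus_eq l_distr l_minus)
  also have "\<dots> = (\<one> \<oplus> s \<otimes> w) \<ominus> s \<otimes> w"
    by (simp only: w(2))
  also have "\<dots> = \<one>"
    using s wc one_closed by algebra
  finally show ?thesis
    using wc that by blast
qed

text \<open>
  The left inverse is the adjoint of a right inverse of \<open>1 - s\<^sup>*\<close>.
\<close>
lemma Units_one_minus:
  assumes s: "s \<in> carrier A" and s1: "anorm A s < 1"
  shows "\<one> \<ominus> s \<in> Units A"
proof -
  obtain w where w: "w \<in> carrier A" "(\<one> \<ominus> s) \<otimes> w = \<one>"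
    using neumann_right_inverse[OF assms] .
  obtain v where v: "v \<in> carrier A" "(\<one> \<ominus> star A s) \<otimes> v = \<one>"
    using neumann_right_inverse[of "star A s"] assms by auto
  have "star A v \<otimes> (\<one> \<ominus> s) = star A ((\<one> \<ominus> star A s) \<otimes> v)"
    using s v(1) by (simp add: star_mult star_minus)
  then have v': "star A v \<otimes> (\<one> \<ominus> s) = \<one>"
    by (simp add: v(2))
  then have "star A v = w"
    using inv_unique[OF v' w(2)] s w(1) v(1) by simp
  with v' w s show ?thesis
    by (auto simp: Units_def)
qed

text \<open>
  Writing the root as \<open>y = 1 - z\<close>, the equation \<open>y\<^sup>2 = 1 - s\<close> becomes \<open>z = (s + z\<^sup>2) / 2\<close>, and the
  right-hand side is a contraction of the ball of radius \<open>\<parallel>s\<parallel>\<close>. The two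
  further properties follow from the equation itself: \<open>z\<close> is self-adjoint because \<open>z\<^sup>*\<close> solves the same equation, and if \<open>w\<close>
  commutes with \<open>s\<close>, then \<open>c = z w - w z\<close> satisfies \<open>2 c = z c + c z\<close>, hence
  \<open>\<parallel>c\<parallel> \<le> \<parallel>s\<parallel> \<parallel>c\<parallel>\<close> and \<open>c = 0\<close>.
\<close>
lemma square_root_one_minus:
  assumes s: "s \<in> carrier A" "star A s = s" and s1: "anorm A s < 1"
  obtains y where "y \<in> carrier A" "star A y = y" "y \<otimes> y = \<one> \<ominus> s"
    and "\<And>w. w \<in> carrier A \<Longrightarrow> s \<otimes> w = w \<otimes> s \<Longrightarrow> y \<otimes> w = w \<otimes> y"
proof -
  let ?\<sigma> = "anorm A s"
  define f where "f = (\<lambda>z. (1/2) \<odot> (s \<oplus> z \<otimes> z))"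
  have \<sigma>0: "0 \<le> ?\<sigma>"
    using s anorm_nonneg by simp
  have f_closed [simp]: "f z \<in> carrier A" if "z \<in> carrier A" for z
    using that s by (simp add: f_def)
  have square_diff: "anorm A (z \<otimes> z \<ominus> w \<otimes> w) \<le> 2 * ?\<sigma> * anorm A (z \<ominus> w)"
    if zw: "z \<in> norm_ball ?\<sigma>" "w \<in> norm_ball ?\<sigma>" for z w
  proof -
    have c: "z \<in> carrier A" "w \<in> carrier A" "anorm A z \<le> ?\<sigma>" "anorm A w \<le> ?\<sigma>"
      using zw by (auto simp: norm_ball_def)
    have "z \<otimes> z \<ominus> w \<otimes> w = z \<otimes> (z \<ominus> w) \<oplus> (z \<ominus> w) \<otimes> w"
      using c by algebra
    then have "anorm A (z \<otimes> z \<ominus> w \<otimes> w) \<le> anorm A (z \<otimes> (z \<ominus> w)) + anorm A ((z \<ominus> w) \<otimes> w)"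
      using c by (simp add: anorm_triangle)
    also have "\<dots> \<le> anorm A z * anorm A (z \<ominus> w) + anorm A (z \<ominus> w) * anorm A w"
      using c anorm_mult by (intro add_mono) auto
    also have "\<dots> \<le> ?\<sigma> * anorm A (z \<ominus> w) + anorm A (z \<ominus> w) * ?\<sigma>"
      using c s by (intro add_mono mult_mono anorm_nonneg) auto
    finally show ?thesis
      by simp
  qed
  have f_ball: "f \<in> norm_ball ?\<sigma> \<rightarrow> norm_ball ?\<sigma>"
  proof
    fix z assume "z \<in> norm_ball ?\<sigma>"
    then have z: "z \<in> carrier A" "anorm A z \<le> ?\<sigma>"
      by (auto simp: norm_ball_def)
    have "anorm A (z \<otimes> z) \<le> ?\<sigma> * ?\<sigma>"
      using anorm_mult[OF z(1) z(1)] mult_mono[OF z(2) z(2) \<sigma>0 anorm_nonneg[OF z(1)]] by simp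
    also have "\<dots> \<le> ?\<sigma>"
      using mult_left_mono[OF less_imp_le[OF s1] \<sigma>0] by simp
    finally have "anorm A (s \<oplus> z \<otimes> z) \<le> 2 * ?\<sigma>"
      using anorm_triangle[of s "z \<otimes> z"] s z by simp
    then show "f z \<in> norm_ball ?\<sigma>"
      using s z by (simp add: norm_ball_def f_def anorm_smult)
  qed
  have f_contr: "anorm A (f z \<ominus> f w) \<le> ?\<sigma> * anorm A (z \<ominus> w)"
    if zw: "z \<in> norm_ball ?\<sigma>" "w \<in> norm_ball ?\<sigma>" for z w
  proof -
    from zw have c: "z \<in> carrier A" "w \<in> carrier A"
      by (auto simp: norm_ball_def)
    have "(s \<oplus> z \<otimes> z) \<ominus> (s \<oplus> w \<otimes> w) = z \<otimes> z \<ominus> w \<otimes> w"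
      using s c by algebra
    moreover have "f z \<ominus> f w = (1/2) \<odot> ((s \<oplus> z \<otimes> z) \<ominus> (s \<oplus> w \<otimes> w))"
      using s c by (simp add: f_def minus_eq uminus_eq_smult smult_add_right)
    ultimately have "anorm A (f z \<ominus> f w) = anorm A (z \<otimes> z \<ominus> w \<otimes> w) / 2"
      using s c by (simp add: anorm_smult)
    with square_diff[OF zw] show ?thesis
      by simp
  qed
  obtain z where z: "z \<in> norm_ball ?\<sigma>" "f z = z"
    and uniq: "\<And>w. w \<in> norm_ball ?\<sigma> \<Longrightarrow> f w = w \<Longrightarrow> w = z"
    using contraction_fixed_point[OF \<sigma>0 s1 f_ball f_contr] by blast
  have zc: "z \<in> carrier A" "anorm A z \<le> ?\<sigma>"
    using z by (auto simp: norm_ball_def)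
  have zz: "z \<otimes> z = 2 \<odot> z \<ominus> s"
  proof -
    have "2 \<odot> f z = s \<oplus> z \<otimes> z"
      using s zc by (simp add: f_def)
    then have "2 \<odot> z \<ominus> s = (s \<oplus> z \<otimes> z) \<ominus> s"
      by (simp add: z(2))
    also have "\<dots> = z \<otimes> z"
      using s zc by algebra
    finally show ?thesis ..
  qed
  have star_z_fixed: "f (star A z) = star A z"
    using arg_cong[OF z(2), of "star A"] s zc
    by (simp add: f_def star_smult star_add star_mult)
  have z_star: "star A z = z"
    by (rule uniq[OF _ star_z_fixed]) (use zc in \<open>simp add: norm_ball_def\<close>)
  have comm: "z \<otimes> w = w \<otimes> z" if w: "w \<in> carrier A" "s \<otimes> w = w \<otimes> s" for w
  proof -
    define c where "c = z \<otimes> w \<ominus> w \<otimes> z"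
    have cc: "c \<in> carrier A"
      using w zc by (simp add: c_def)
    have "z \<otimes> c \<oplus> c \<otimes> z = (z \<otimes> z) \<otimes> w \<ominus> w \<otimes> (z \<otimes> z)"
      unfolding c_def using w zc by algebra
    also have "\<dots> = 2 \<odot> c"
      using s zc w unfolding zz
      by (simp add: c_def algebra_rules) (simp add: a_ac add_uminus_cancel)
    finally have "2 * anorm A c = anorm A (z \<otimes> c \<oplus> c \<otimes> z)"
      using cc by (simp add: anorm_smult)
    also have "\<dots> \<le> anorm A (z \<otimes> c) + anorm A (c \<otimes> z)"
      using cc zc by (simp add: anorm_triangle)
    also have "\<dots> \<le> anorm A z * anorm A c + anorm A c * anorm A z"
      using cc zc anorm_mult by (intro add_mono) auto
    also have "\<dots> \<le> 2 * (?\<sigma> * anorm A c)"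
      using mult_right_mono[OF zc(2) anorm_nonneg[OF cc]] by (simp add: mult.commute)
    finally have "(1 - ?\<sigma>) * anorm A c \<le> 0"
      by (simp add: algebra_simps)
    then have "anorm A c = 0"
      using s1 anorm_nonneg[OF cc] by (simp add: mult_le_0_iff)
    then show ?thesis
      using cc w zc by (simp add: anorm_eq_0_iff c_def minus_eq_zero_iff)
  qed
  show ?thesis
  proof
    show "\<one> \<ominus> z \<in> carrier A" "star A (\<one> \<ominus> z) = \<one> \<ominus> z"
      using zc z_star by (simp_all add: star_minus)
    have "(\<one> \<ominus> z) \<otimes> (\<one> \<ominus> z) = \<one> \<oplus> z \<otimes> z \<ominus> 2 \<odot> z"
      using zc smult_add_left[of z 1 1]
      by (simp add: algebra_rules) (simp add: a_ac)
    also have "\<dots> = \<one> \<ominus> s"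
      unfolding zz using s zc smult_closed[of z 2] one_closed by algebra
    finally show "(\<one> \<ominus> z) \<otimes> (\<one> \<ominus> z) = \<one> \<ominus> s" .
  next
    fix w assume w: "w \<in> carrier A" "s \<otimes> w = w \<otimes> s"
    then show "(\<one> \<ominus> z) \<otimes> w = w \<otimes> (\<one> \<ominus> z)"
      using comm[OF w] zc by (simp add: minus_eq l_distr r_distr l_minus r_minus)
  qed
qed

lemma UnitsI:
  assumes "a \<in> carrier A" "x \<in> carrier A" "y \<in> carrier A" "x \<otimes> a = \<one>" "a \<otimes> y = \<one>"
  shows "a \<in> Units A"
  using inv_unique[OF assms(4,5,1,2,3)] assms by (auto simp: Units_def)

lemma Units_smult:
  assumes a: "a \<in> Units A" and c: "c \<noteq> 0"
  shows "c \<odot> a \<in> Units A"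
  by (rule UnitsI[of _ "(1/c) \<odot> inv a" "(1/c) \<odot> inv a"])
    (use assms in \<open>auto simp: smult_mult_left smult_mult_right Units_closed\<close>)

lemma Units_uminus: "a \<in> Units A \<Longrightarrow> \<ominus> a \<in> Units A"
  using Units_smult[of a "-1"] by (simp add: uminus_eq_smult Units_closed)

lemma Units_if_square:
  assumes y: "y \<in> carrier A" and yy: "y \<otimes> y \<in> Units A"
  shows "y \<in> Units A"
proof (rule UnitsI[of _ "inv (y \<otimes> y) \<otimes> y" "y \<otimes> inv (y \<otimes> y)"])
  show "inv (y \<otimes> y) \<otimes> y \<otimes> y = \<one>" "y \<otimes> (y \<otimes> inv (y \<otimes> y)) = \<one>"
    using Units_l_inv[OF yy] Units_r_inv[OF yy] y Units_inv_closed[OF yy]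
    by (simp_all add: m_assoc)
qed (use y yy in auto)

lemma star_inv:
  assumes a: "a \<in> Units A" "star A a = a"
  shows "star A (inv a) = inv a"
proof -
  have "star A (inv a) \<otimes> a = star A (a \<otimes> inv a)"
    using a star_mult[of a "inv a"] by (simp add: Units_closed del: Units_r_inv)
  then have "star A (inv a) \<otimes> a = \<one>"
    using a by simp
  then show ?thesis
    using inv_unique[of "star A (inv a)" a "inv a"] a by (simp add: Units_closed)
qed

lemma commute_inv:
  assumes a: "a \<in> Units A" and w: "w \<in> carrier A" and aw: "a \<otimes> w = w \<otimes> a"
  shows "inv a \<otimes> w = w \<otimes> inv a"
proof -
  have "inv a \<otimes> w = inv a \<otimes> (w \<otimes> a) \<otimes> inv a"
    using a w by (simp add: m_assoc Units_closed)
  also have "\<dots> = w \<otimes> inv a"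
    using a w by (simp flip: aw add: m_assoc[symmetric] Units_closed)
  finally show ?thesis .
qed

text \<open>
  If \<open>a\<^sup>2 + g\<^sup>2 = t\<close>, then \<open>u = a + \<i> g\<close> satisfies \<open>u\<^sup>* u = t\<close>, and \<open>a\<close> is the mean of \<open>u\<close> and
  \<open>u\<^sup>*\<close>, which have the same norm.
\<close>
lemma anorm_le_of_circle:
  assumes a: "a \<in> carrier A" "star A a = a" and g: "g \<in> carrier A" "star A g = g"
    and comm: "g \<otimes> a = a \<otimes> g" and t: "0 \<le> t"
    and circle: "a \<otimes> a \<oplus> g \<otimes> g = complex_of_real t \<odot> \<one>"
  shows "(anorm A a)\<^sup>2 \<le> t"
proof -
  define u where "u = a \<oplus> \<i> \<odot> g"
  have u: "u \<in> carrier A" "star A u = a \<oplus> (-\<i>) \<odot> g"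
    using a g by (simp_all add: u_def star_add star_smult)
  have "star A u \<otimes> u = (a \<oplus> (-\<i>) \<odot> g) \<otimes> (a \<oplus> \<i> \<odot> g)"
    using u(2) by (simp add: u_def)
  also have "\<dots> = a \<otimes> a \<oplus> g \<otimes> g"
    using a g comm
    by (simp add: algebra_rules) (simp add: a_ac smult_add_left[symmetric] add_smult_cancel)
  finally have "(anorm A u)\<^sup>2 = t * anorm A \<one>"
    using circle cstar_identity[OF u(1)] t by (simp add: anorm_smult)
  also have "\<dots> \<le> t"
    using mult_left_mono[OF anorm_one_le t] by simp
  finally have u_le: "(anorm A u)\<^sup>2 \<le> t" .
  have "u \<oplus> star A u = (a \<oplus> \<i> \<odot> g) \<oplus> (a \<oplus> (-\<i>) \<odot> g)"
    using u(2) by (simp add: u_def)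
  also have "\<dots> = 2 \<odot> a"
    using a g smult_add_left[of a 1 1] smult_add_left[of g \<i> "-\<i>", symmetric]
    by (simp add: a_ac add_smult_cancel)
  finally have "2 * anorm A a = anorm A (u \<oplus> star A u)"
    using a by (simp add: anorm_smult)
  also have "\<dots> \<le> 2 * anorm A u"
    using anorm_triangle[OF u(1) star_closed[OF u(1)]] u(1) by simp
  finally have "(anorm A a)\<^sup>2 \<le> (anorm A u)\<^sup>2"
    using anorm_nonneg[OF a(1)] by (intro power_mono) auto
  with u_le show ?thesis
    by simp
qed

text \<open>
  This says that \<open>\<parallel>a\<parallel>\<close> or \<open>-\<parallel>a\<parallel>\<close> lies in the spectrum of a self-adjoint \<open>a \<noteq> 0\<close>. Let
  \<open>m = \<parallel>a\<parallel>\<^sup>2\<close>. For \<open>d > m\<close> the element \<open>B = d - a\<^sup>2\<close> is \<open>d\<close> times some \<open>1 - s\<close> with \<open>\<parallel>s\<parallel> < 1\<close>,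
  so it has a square root. If \<open>m - a\<^sup>2\<close> were invertible, the inverses \<open>R\<close> of \<open>B\<close> would stay bounded as
  \<open>d = m + \<delta>\<close> decreases to \<open>m\<close>, so that \<open>1 - 2 \<delta> R\<close> would have a square root too. The product of
  the two roots is a root \<open>g\<close> of \<open>B (1 - 2 \<delta> R) = (m - \<delta>) - a\<^sup>2\<close>, and the previous lemma gives
  \<open>\<parallel>a\<parallel>\<^sup>2 \<le> m - \<delta>\<close>.
\<close>
lemma anorm_square_not_unit:
  assumes a: "a \<in> carrier A" "star A a = a" and a0: "a \<noteq> \<zero>"
  shows "complex_of_real ((anorm A a)\<^sup>2) \<odot> \<one> \<ominus> a \<otimes> a \<notin> Units A"
proof
  define m where "m = (anorm A a)\<^sup>2"
  have m: "0 < m"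
    using a a0 anorm_nonneg[of a] anorm_eq_0_iff[of a] by (simp add: m_def)
  define D where "D = complex_of_real m \<odot> \<one> \<ominus> a \<otimes> a"
  assume "complex_of_real ((anorm A a)\<^sup>2) \<odot> \<one> \<ominus> a \<otimes> a \<in> Units A"
  then have D: "D \<in> Units A"
    by (simp add: D_def m_def)
  define r where "r = inv D"
  have r: "r \<in> carrier A" "0 \<le> anorm A r"
    using D by (auto simp: r_def anorm_nonneg)
  \<comment> \<open>Small enough that \<open>\<delta> \<parallel>r\<parallel> \<le> 1/4\<close>, which makes \<open>2 \<delta> \<parallel>R\<parallel> \<le> 2/3\<close> below.\<close>
  define \<delta> where "\<delta> = min m (1 / (4 * (anorm A r + 1)))"
  have \<delta>: "0 < \<delta>" "\<delta> \<le> m"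
    using m r(2) by (auto simp: \<delta>_def)
  have "\<delta> * anorm A r \<le> 1 / (4 * (anorm A r + 1)) * anorm A r"
    using r(2) by (intro mult_right_mono) (simp_all add: \<delta>_def)
  also have "\<dots> \<le> 1 / 4"
    using r(2) by (simp add: field_simps)
  finally have \<delta>r: "\<delta> * anorm A r \<le> 1 / 4" .
  define d where "d = m + \<delta>"
  have d: "0 < d" "m < d"
    using m \<delta> by (auto simp: d_def)
  define s where "s = complex_of_real (1 / d) \<odot> (a \<otimes> a)"
  have s: "s \<in> carrier A" "star A s = s"
    using a by (simp_all add: s_def star_smult star_mult)
  have "anorm A (a \<otimes> a) \<le> m"
    using anorm_mult[OF a(1) a(1)] by (simp add: m_def power2_eq_square)
  then have s1: "anorm A s < 1"
    using a d by (simp add: s_def anorm_smult norm_divide)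
  define B where "B = complex_of_real d \<odot> (\<one> \<ominus> s)"
  have B: "B \<in> Units A"
    using Units_smult[OF Units_one_minus[OF s(1) s1]] d by (simp add: B_def)
  have Bc: "B \<in> carrier A"
    using B by (rule Units_closed)
  have B_eq: "B = complex_of_real d \<odot> \<one> \<ominus> a \<otimes> a"
    using a d by (simp add: B_def s_def minus_eq smult_add_right smult_uminus uminus_eq_smult)
  have B_D: "B = D \<oplus> complex_of_real \<delta> \<odot> \<one>"
    using a by (simp add: B_eq D_def d_def minus_eq smult_add_left a_ac)
  have B_star: "star A B = B"
    using s d by (simp add: B_def star_smult star_minus)
  define R where "R = inv B"
  have R: "R \<in> carrier A" "star A R = R" "B \<otimes> R = \<one>"
    using B star_inv[OF B B_star] by (auto simp: R_def)
  \<comment> \<open>The resolvent identity \<open>r = R + \<delta> r R\<close>, which bounds the norm of \<open>R\<close> by that of \<open>r\<close>.\<close>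
  have "r = r \<otimes> (B \<otimes> R)"
    using r R by simp
  also have "\<dots> = (r \<otimes> D) \<otimes> R \<oplus> complex_of_real \<delta> \<odot> (r \<otimes> R)"
    using r R(1) Units_closed[OF D] unfolding B_D
    by (simp add: l_distr r_distr m_assoc smult_mult_left smult_mult_right)
  also have "r \<otimes> D = \<one>"
    using D by (simp add: r_def)
  finally have r_eq: "R \<oplus> complex_of_real \<delta> \<odot> (r \<otimes> R) = r"
    using R by simp
  have "R = (R \<oplus> complex_of_real \<delta> \<odot> (r \<otimes> R)) \<ominus> complex_of_real \<delta> \<odot> (r \<otimes> R)"
    using r R by (simp add: minus_eq a_assoc r_neg)
  also note r_eq
  finally have "R = r \<ominus> complex_of_real \<delta> \<odot> (r \<otimes> R)" .
  then have "anorm A R \<le> anorm A r + \<delta> * anorm A (r \<otimes> R)"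
    using anorm_minus_le[of r "complex_of_real \<delta> \<odot> (r \<otimes> R)"] r R \<delta>
    by (simp add: anorm_smult)
  also have "\<dots> \<le> anorm A r + \<delta> * (anorm A r * anorm A R)"
    using anorm_mult[OF r(1) R(1)] \<delta> by simp
  also have "\<dots> \<le> anorm A r + 1 / 4 * anorm A R"
    using mult_right_mono[OF \<delta>r anorm_nonneg[OF R(1)]] by simp
  finally have "\<delta> * anorm A R \<le> \<delta> * (4 / 3 * anorm A r)"
    using \<delta> by (intro mult_left_mono) auto
  with \<delta>r have R_le: "2 * \<delta> * anorm A R < 1"
    by simp
  define s' where "s' = complex_of_real (2 * \<delta>) \<odot> R"
  have s': "s' \<in> carrier A" "star A s' = s'" "anorm A s' < 1"
    using R R_le \<delta> by (simp_all add: s'_def star_smult anorm_smult)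
  obtain y where y: "y \<in> carrier A" "star A y = y" "y \<otimes> y = \<one> \<ominus> s"
    and y_comm: "\<And>w. w \<in> carrier A \<Longrightarrow> s \<otimes> w = w \<otimes> s \<Longrightarrow> y \<otimes> w = w \<otimes> y"
    using square_root_one_minus[OF s s1] by metis
  obtain z where z: "z \<in> carrier A" "star A z = z" "z \<otimes> z = \<one> \<ominus> s'"
    and z_comm: "\<And>w. w \<in> carrier A \<Longrightarrow> s' \<otimes> w = w \<otimes> s' \<Longrightarrow> z \<otimes> w = w \<otimes> z"
    using square_root_one_minus[OF s'] by metis
  have sa: "s \<otimes> a = a \<otimes> s"
    using a by (simp add: s_def smult_mult_left smult_mult_right m_assoc)
  have "B \<otimes> a = a \<otimes> B"
    using a s sa by (simp add: B_def smult_mult_left smult_mult_right minus_eq l_distr r_distr l_minus r_minus)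
  then have "R \<otimes> a = a \<otimes> R"
    using commute_inv[OF B a(1)] by (simp add: R_def)
  then have s'a: "s' \<otimes> a = a \<otimes> s'"
    using a R by (simp add: s'_def smult_mult_left smult_mult_right)
  have "s' \<otimes> (a \<otimes> a) = (a \<otimes> a) \<otimes> s'"
    using a s'(1) s'a by (metis m_assoc)
  then have s's: "s' \<otimes> s = s \<otimes> s'"
    using a s' by (simp add: s_def smult_mult_left smult_mult_right)
  have ya: "y \<otimes> a = a \<otimes> y" and za: "z \<otimes> a = a \<otimes> z" and zs: "z \<otimes> s = s \<otimes> z"
    using y_comm[OF a(1) sa] z_comm[OF a(1) s'a] z_comm[OF s(1) s's] by auto
  have yz: "y \<otimes> z = z \<otimes> y"
    using y_comm[OF z(1)] zs by simp
  define g where "g = complex_of_real (sqrt d) \<odot> (y \<otimes> z)"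
  have g: "g \<in> carrier A" "star A g = g"
    using y z yz by (simp_all add: g_def star_smult star_mult)
  have "g \<otimes> g = complex_of_real d \<odot> ((y \<otimes> z) \<otimes> (y \<otimes> z))"
    using y z d by (simp add: g_def smult_mult_left smult_mult_right flip: of_real_mult)
  also have "(y \<otimes> z) \<otimes> (y \<otimes> z) = (y \<otimes> y) \<otimes> (z \<otimes> z)"
    using y(1) z(1) yz by (metis m_assoc m_closed)
  also have "complex_of_real d \<odot> \<dots> = B \<otimes> (\<one> \<ominus> s')"
    using y z s s' by (simp add: B_def smult_mult_left)
  also have "\<dots> = B \<ominus> complex_of_real (2 * \<delta>) \<odot> (B \<otimes> R)"
    using Bc R by (simp add: s'_def minus_eq r_distr r_minus smult_mult_right)
  also have "\<dots> = complex_of_real (m - \<delta>) \<odot> \<one> \<ominus> a \<otimes> a"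
  proof -
    have "complex_of_real (m - \<delta>) \<odot> \<one>
        = complex_of_real d \<odot> \<one> \<oplus> (- complex_of_real (2 * \<delta>)) \<odot> \<one>"
      by (subst smult_add_left[symmetric]) (simp_all add: d_def)
    then show ?thesis
      unfolding R(3) using a by (simp add: B_eq minus_eq uminus_eq_smult a_ac)
  qed
  finally have "a \<otimes> a \<oplus> g \<otimes> g = a \<otimes> a \<oplus> (complex_of_real (m - \<delta>) \<odot> \<one> \<ominus> a \<otimes> a)"
    by simp
  also have "\<dots> = complex_of_real (m - \<delta>) \<odot> \<one>"
    using a smult_closed[OF one_closed, of "complex_of_real (m - \<delta>)"] by algebra
  finally have "a \<otimes> a \<oplus> g \<otimes> g = complex_of_real (m - \<delta>) \<odot> \<one>" .
  moreover have "g \<otimes> a = a \<otimes> g"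
    using a y z ya za by (simp add: g_def smult_mult_left smult_mult_right) (metis m_assoc)
  ultimately have "(anorm A a)\<^sup>2 \<le> m - \<delta>"
    using anorm_le_of_circle[OF a g] \<delta> by simp
  then show False
    using \<delta> by (simp add: m_def)
qed

text \<open>
  If \<open>m = \<parallel>a\<parallel>\<close> exceeded \<open>L\<close>, then \<open>m - a\<close> would be invertible by hypothesis and \<open>-m - a\<close> by
  positivity, hence also their product \<open>a\<^sup>2 - m\<^sup>2\<close>.
\<close>
lemma anorm_le_if_Units:
  assumes a: "positive A a" and L: "0 \<le> L"
    and units: "\<And>l. L < l \<Longrightarrow> complex_of_real l \<odot> \<one> \<ominus> a \<in> Units A"
  shows "anorm A a \<le> L"
proof (rule ccontr)
  assume "\<not> anorm A a \<le> L"
  define m where "m = anorm A a"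
  have m: "L < m"
    using \<open>\<not> anorm A a \<le> L\<close> by (simp add: m_def)
  have ac: "a \<in> carrier A" "star A a = a"
    using a by (auto simp: positive_def)
  have "a \<noteq> \<zero>"
    using m L by (auto simp: m_def)
  have "complex_of_real (- m) \<notin> spectrum A a"
    using a m L by (auto simp: positive_def)
  then have "complex_of_real (- m) \<odot> \<one> \<ominus> a \<in> Units A"
    by (simp add: spectrum_def)
  then have "(complex_of_real m \<odot> \<one> \<ominus> a) \<otimes> (\<ominus> (complex_of_real (- m) \<odot> \<one> \<ominus> a)) \<in> Units A"
    using units[OF m] by (intro Units_m_closed Units_uminus)
  also have "(complex_of_real m \<odot> \<one> \<ominus> a) \<otimes> (\<ominus> (complex_of_real (- m) \<odot> \<one> \<ominus> a))
      = complex_of_real (m\<^sup>2) \<odot> \<one> \<ominus> a \<otimes> a"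
    using ac by (simp add: algebra_rules power2_eq_square) (simp add: a_ac add_uminus_cancel add_smult_cancel)
  finally show False
    using anorm_square_not_unit[OF ac \<open>a \<noteq> \<zero>\<close>] by (simp add: m_def)
qed

end

section \<open>Orthonormal systems in Hilbert modules\<close>

context hilbert_module
begin

sublocale V: abelian_group M
  by (rule module.axioms(2)[OF M_vector_space])

lemma M_smult_0 [simp]: "x \<in> carrier M \<Longrightarrow> 0 \<odot>\<^bsub>M\<^esub> x = \<zero>\<^bsub>M\<^esub>"
  using module.smult_l_null[OF M_vector_space, of x] by (simp add: complex_field_def)

lemma M_uminus_eq_smult:
  assumes x: "x \<in> carrier M"
  shows "\<ominus>\<^bsub>M\<^esub> x = (-1) \<odot>\<^bsub>M\<^esub> x"
proof (rule V.minus_equality)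
  interpret Module.module complex_field M
    by (rule M_vector_space)
  show "(-1) \<odot>\<^bsub>M\<^esub> x \<in> carrier M"
    using smult_closed[of "-1" x] x by (simp add: complex_field_def)
  show "(-1) \<odot>\<^bsub>M\<^esub> x \<oplus>\<^bsub>M\<^esub> x = \<zero>\<^bsub>M\<^esub>"
    using smult_l_distr[of "-1" 1 x] smult_one[of x] x by (simp add: complex_field_def)
qed (rule x)

declare ract_closed [simp, intro] inprod_closed [simp, intro]

lemma inprod_add_left:
  "x \<in> carrier M \<Longrightarrow> y \<in> carrier M \<Longrightarrow> z \<in> carrier M \<Longrightarrow>
    inprod M (x \<oplus>\<^bsub>M\<^esub> y) z = inprod M x z \<oplus>\<^bsub>A\<^esub> inprod M y z"
  using arg_cong[OF inprod_add_right[of z x y], of "star A"] by (simp add: star_inprod star_add)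

lemma inprod_ract_left:
  "x \<in> carrier M \<Longrightarrow> y \<in> carrier M \<Longrightarrow> a \<in> carrier A \<Longrightarrow>
    inprod M (ract M x a) y = star A a \<otimes>\<^bsub>A\<^esub> inprod M x y"
  using arg_cong[OF inprod_ract_right[of y x a], of "star A"] by (simp add: star_inprod star_mult)

lemma inprod_zero_right [simp]: "x \<in> carrier M \<Longrightarrow> inprod M x \<zero>\<^bsub>M\<^esub> = \<zero>\<^bsub>A\<^esub>"
  using inprod_smult_right[of x "\<zero>\<^bsub>M\<^esub>" 0] by simp

lemma inprod_uminus_right:
  "x \<in> carrier M \<Longrightarrow> y \<in> carrier M \<Longrightarrow> inprod M x (\<ominus>\<^bsub>M\<^esub> y) = \<ominus>\<^bsub>A\<^esub> inprod M x y"
  by (simp add: M_uminus_eq_smult inprod_smult_right uminus_eq_smult)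

lemma inprod_minus_right:
  "x \<in> carrier M \<Longrightarrow> y \<in> carrier M \<Longrightarrow> z \<in> carrier M \<Longrightarrow>
    inprod M x (y \<ominus>\<^bsub>M\<^esub> z) = inprod M x y \<ominus>\<^bsub>A\<^esub> inprod M x z"
  by (simp add: V.minus_eq minus_eq inprod_add_right inprod_uminus_right)

lemma inprod_minus_left:
  "x \<in> carrier M \<Longrightarrow> y \<in> carrier M \<Longrightarrow> z \<in> carrier M \<Longrightarrow>
    inprod M (x \<ominus>\<^bsub>M\<^esub> y) z = inprod M x z \<ominus>\<^bsub>A\<^esub> inprod M y z"
  using arg_cong[OF inprod_minus_right[of z x y], of "star A"] by (simp add: star_inprod star_minus)

lemma inprod_eq_zero_commute:
  "x \<in> carrier M \<Longrightarrow> y \<in> carrier M \<Longrightarrow> inprod M x y = \<zero>\<^bsub>A\<^esub> \<Longrightarrow> inprod M y x = \<zero>\<^bsub>A\<^esub>"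
  using star_inprod[of x y] by simp

lemma inprod_finsum_right:
  assumes "finite F" "x \<in> carrier M" "f \<in> F \<rightarrow> carrier M"
  shows "inprod M x (finsum M f F) = finsum A (\<lambda>i. inprod M x (f i)) F"
  using assms by (induction F) (auto simp: Pi_iff inprod_add_right)

lemma inprod_uminus_left:
  "x \<in> carrier M \<Longrightarrow> y \<in> carrier M \<Longrightarrow> inprod M (\<ominus>\<^bsub>M\<^esub> x) y = \<ominus>\<^bsub>A\<^esub> inprod M x y"
  using arg_cong[OF inprod_uminus_right[of y x], of "star A"] by (simp add: star_inprod star_uminus)

lemma hnorm_nonneg: "x \<in> carrier M \<Longrightarrow> 0 \<le> hnorm A M x"
  by (simp add: hnorm_def anorm_nonneg)

lemma hnorm_uminus: "x \<in> carrier M \<Longrightarrow> hnorm A M (\<ominus>\<^bsub>M\<^esub> x) = hnorm A M x"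
  by (simp add: hnorm_def inprod_uminus_left inprod_uminus_right minus_minus)

lemma hnorm_minus_commute:
  assumes "x \<in> carrier M" "y \<in> carrier M"
  shows "hnorm A M (x \<ominus>\<^bsub>M\<^esub> y) = hnorm A M (y \<ominus>\<^bsub>M\<^esub> x)"
  using hnorm_uminus[of "x \<ominus>\<^bsub>M\<^esub> y"] assms
  by (simp add: V.minus_eq V.minus_add V.minus_minus V.a_comm)

text \<open>
  With \<open>c = \<langle>u, u\<rangle> + \<langle>v, v\<rangle>\<close> and \<open>l > \<parallel>c\<parallel>\<close>, the element \<open>l - c\<close> is \<open>l y\<^sup>2\<close> with \<open>y\<close> self-adjoint and
  invertible. For \<open>w = y\<^sup>-\<^sup>1\<close> this gives \<open>l - \<langle>u, u\<rangle> = l y\<^sup>2 + \<langle>v, v\<rangle> = y (l + \<langle>v w, v w\<rangle>) y\<close>, and the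
  middle factor is invertible because \<open>\<langle>v w, v w\<rangle>\<close> is positive.
\<close>
lemma Units_minus_inprod:
  assumes u: "u \<in> carrier M" and v: "v \<in> carrier M"
    and l: "anorm A (inprod M u u \<oplus>\<^bsub>A\<^esub> inprod M v v) < l"
  shows "complex_of_real l \<odot>\<^bsub>A\<^esub> \<one>\<^bsub>A\<^esub> \<ominus>\<^bsub>A\<^esub> inprod M u u \<in> Units A"
proof -
  let ?a = "inprod M u u" and ?b = "inprod M v v" and ?l = "complex_of_real l"
  define c where "c = ?a \<oplus>\<^bsub>A\<^esub> ?b"
  have c: "c \<in> carrier A" "star A c = c" "0 \<le> anorm A c"
    using u v by (simp_all add: c_def star_add star_inprod anorm_nonneg)
  have l0: "0 < l"
    using l c(3) by (simp add: c_def)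
  define s where "s = complex_of_real (1 / l) \<odot>\<^bsub>A\<^esub> c"
  have s: "s \<in> carrier A" "star A s = s" "anorm A s < 1"
    using c l l0 by (simp_all add: s_def star_smult anorm_smult norm_divide flip: c_def)
  obtain y where y: "y \<in> carrier A" "star A y = y" "y \<otimes>\<^bsub>A\<^esub> y = \<one>\<^bsub>A\<^esub> \<ominus>\<^bsub>A\<^esub> s"
    using square_root_one_minus[OF s] by metis
  have yU: "y \<in> Units A"
    using Units_if_square[OF y(1)] Units_one_minus[OF s(1,3)] y(3) by simp
  define w where "w = inv\<^bsub>A\<^esub> y"
  have w: "w \<in> carrier A" "star A w = w" "w \<otimes>\<^bsub>A\<^esub> y = \<one>\<^bsub>A\<^esub>" "y \<otimes>\<^bsub>A\<^esub> w = \<one>\<^bsub>A\<^esub>"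
    using yU star_inv[OF yU y(2)] by (auto simp: w_def)
  define p where "p = w \<otimes>\<^bsub>A\<^esub> (?b \<otimes>\<^bsub>A\<^esub> w)"
  have p: "p \<in> carrier A"
    using w v by (simp add: p_def)
  have "p = inprod M (ract M v w) (ract M v w)"
    using v w by (simp add: p_def inprod_ract_left inprod_ract_right m_assoc)
  then have "positive A p"
    using inprod_positive v w by simp
  moreover have "- ?l \<notin> \<real>\<^sub>\<ge>\<^sub>0"
    using l0 by (auto simp: nonneg_Reals_def complex_eq_iff)
  ultimately have "(- ?l) \<odot>\<^bsub>A\<^esub> \<one>\<^bsub>A\<^esub> \<ominus>\<^bsub>A\<^esub> p \<in> Units A"
    by (auto simp: positive_def spectrum_def)
  then have "y \<otimes>\<^bsub>A\<^esub> (\<ominus>\<^bsub>A\<^esub> ((- ?l) \<odot>\<^bsub>A\<^esub> \<one>\<^bsub>A\<^esub> \<ominus>\<^bsub>A\<^esub> p)) \<otimes>\<^bsub>A\<^esub> y \<in> Units A"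
    using yU by (intro Units_m_closed Units_uminus)
  also have "\<ominus>\<^bsub>A\<^esub> ((- ?l) \<odot>\<^bsub>A\<^esub> \<one>\<^bsub>A\<^esub> \<ominus>\<^bsub>A\<^esub> p) = ?l \<odot>\<^bsub>A\<^esub> \<one>\<^bsub>A\<^esub> \<oplus>\<^bsub>A\<^esub> p"
    using p by (simp add: minus_eq uminus_eq_smult smult_add_right)
  also have "y \<otimes>\<^bsub>A\<^esub> (?l \<odot>\<^bsub>A\<^esub> \<one>\<^bsub>A\<^esub> \<oplus>\<^bsub>A\<^esub> p) \<otimes>\<^bsub>A\<^esub> y
      = ?l \<odot>\<^bsub>A\<^esub> (y \<otimes>\<^bsub>A\<^esub> y) \<oplus>\<^bsub>A\<^esub> y \<otimes>\<^bsub>A\<^esub> p \<otimes>\<^bsub>A\<^esub> y"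
    using p y(1) by (simp add: l_distr r_distr smult_mult_left smult_mult_right)
  also have "y \<otimes>\<^bsub>A\<^esub> p \<otimes>\<^bsub>A\<^esub> y = (y \<otimes>\<^bsub>A\<^esub> w) \<otimes>\<^bsub>A\<^esub> ?b \<otimes>\<^bsub>A\<^esub> (w \<otimes>\<^bsub>A\<^esub> y)"
    using w(1) y(1) v by (simp add: p_def m_assoc)
  also have "\<dots> = ?b"
    using w v by simp
  also have "?l \<odot>\<^bsub>A\<^esub> (y \<otimes>\<^bsub>A\<^esub> y) = ?l \<odot>\<^bsub>A\<^esub> \<one>\<^bsub>A\<^esub> \<ominus>\<^bsub>A\<^esub> c"
    unfolding y(3) using l0 c by (simp add: s_def minus_eq smult_add_right smult_uminus uminus_eq_smult)
  also have "?l \<odot>\<^bsub>A\<^esub> \<one>\<^bsub>A\<^esub> \<ominus>\<^bsub>A\<^esub> c \<oplus>\<^bsub>A\<^esub> ?b = ?l \<odot>\<^bsub>A\<^esub> \<one>\<^bsub>A\<^esub> \<ominus>\<^bsub>A\<^esub> ?a"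
  proof -
    have "t \<ominus>\<^bsub>A\<^esub> (a \<oplus>\<^bsub>A\<^esub> b) \<oplus>\<^bsub>A\<^esub> b = t \<ominus>\<^bsub>A\<^esub> a"
      if "t \<in> carrier A" "a \<in> carrier A" "b \<in> carrier A" for t a b
      using that by algebra
    then show ?thesis
      using u v by (simp add: c_def)
  qed
  finally show ?thesis .
qed

text \<open>
  By orthogonality the inner square of \<open>u + v\<close> is \<open>\<langle>u, u\<rangle> + \<langle>v, v\<rangle>\<close>. Neither the numbers above the norm of
  this sum nor the negative numbers are in the spectrum of \<open>\<langle>u, u\<rangle>\<close>, which bounds its norm.
\<close>
lemma hnorm_le_hnorm_add:
  assumes u: "u \<in> carrier M" and v: "v \<in> carrier M" and orth: "inprod M u v = \<zero>\<^bsub>A\<^esub>"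
  shows "hnorm A M u \<le> hnorm A M (u \<oplus>\<^bsub>M\<^esub> v)"
proof -
  have eq: "inprod M (u \<oplus>\<^bsub>M\<^esub> v) (u \<oplus>\<^bsub>M\<^esub> v) = inprod M u u \<oplus>\<^bsub>A\<^esub> inprod M v v"
    using u v orth inprod_eq_zero_commute[OF u v orth]
    by (simp add: inprod_add_left inprod_add_right)
  have "anorm A (inprod M u u) \<le> anorm A (inprod M u u \<oplus>\<^bsub>A\<^esub> inprod M v v)"
    using Units_minus_inprod[OF u v] inprod_positive[OF u] u v
    by (intro anorm_le_if_Units) (auto intro: anorm_nonneg)
  then show ?thesis
    by (simp add: hnorm_def eq)
qed

definition proj :: "('i \<Rightarrow> 'm) \<Rightarrow> 'i set \<Rightarrow> 'm \<Rightarrow> 'm" where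
  "proj e F x = finsum M (\<lambda>i. ract M (e i) (inprod M (e i) x)) F"

context
  fixes I :: "'i set" and e :: "'i \<Rightarrow> 'm"
  assumes orthonormal: "orthonormal_system A M I e"
begin

lemma e_closed [simp, intro]: "i \<in> I \<Longrightarrow> e i \<in> carrier M"
  using orthonormal by (simp add: orthonormal_system_def)

lemma inprod_e: "i \<in> I \<Longrightarrow> j \<in> I \<Longrightarrow> inprod M (e i) (e j) = (if i = j then \<one>\<^bsub>A\<^esub> else \<zero>\<^bsub>A\<^esub>)"
  using orthonormal by (auto simp: orthonormal_system_def)

lemma combination_closed [simp, intro]:
  "F \<subseteq> I \<Longrightarrow> a \<in> F \<rightarrow> carrier A \<Longrightarrow> finsum M (\<lambda>i. ract M (e i) (a i)) F \<in> carrier M"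
  by (intro V.finsum_closed) auto

lemma proj_closed [simp, intro]: "F \<subseteq> I \<Longrightarrow> x \<in> carrier M \<Longrightarrow> proj e F x \<in> carrier M"
  unfolding proj_def by (rule combination_closed) auto

lemma inprod_combination:
  assumes "finite F" "F \<subseteq> I" "a \<in> F \<rightarrow> carrier A" "x \<in> carrier M"
  shows "inprod M x (finsum M (\<lambda>i. ract M (e i) (a i)) F)
    = finsum A (\<lambda>i. inprod M x (e i) \<otimes>\<^bsub>A\<^esub> a i) F"
proof -
  have "inprod M x (finsum M (\<lambda>i. ract M (e i) (a i)) F)
      = finsum A (\<lambda>i. inprod M x (ract M (e i) (a i))) F"
    using assms by (intro inprod_finsum_right) auto
  also have "\<dots> = finsum A (\<lambda>i. inprod M x (e i) \<otimes>\<^bsub>A\<^esub> a i) F"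
    using assms by (intro finsum_cong') (auto simp: Pi_iff subset_iff inprod_ract_right)
  finally show ?thesis .
qed

lemma coefficient_combination:
  assumes F: "finite F" "F \<subseteq> I" and a: "a \<in> F \<rightarrow> carrier A" and j: "j \<in> F"
  shows "inprod M (e j) (finsum M (\<lambda>i. ract M (e i) (a i)) F) = a j"
proof -
  have "inprod M (e j) (finsum M (\<lambda>i. ract M (e i) (a i)) F)
      = finsum A (\<lambda>i. inprod M (e j) (e i) \<otimes>\<^bsub>A\<^esub> a i) F"
    using assms by (intro inprod_combination) auto
  also have "\<dots> = finsum A (\<lambda>i. if j = i then a i else \<zero>\<^bsub>A\<^esub>) F"
    using assms by (intro finsum_cong') (auto simp: Pi_iff subset_iff inprod_e)
  also have "\<dots> = a j"
    using F a j by (intro finsum_singleton) auto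
  finally show ?thesis .
qed

lemma inprod_residual_e:
  assumes "finite F" "F \<subseteq> I" "x \<in> carrier M" "i \<in> F"
  shows "inprod M (x \<ominus>\<^bsub>M\<^esub> proj e F x) (e i) = \<zero>\<^bsub>A\<^esub>"
proof (rule inprod_eq_zero_commute)
  have "inprod M (e i) (proj e F x) = inprod M (e i) x"
    unfolding proj_def using assms by (intro coefficient_combination) auto
  then show "inprod M (e i) (x \<ominus>\<^bsub>M\<^esub> proj e F x) = \<zero>\<^bsub>A\<^esub>"
    using assms by (subst inprod_minus_right) (auto simp: minus_eq r_neg)
qed (use assms in auto)

lemma inprod_residual_combination:
  assumes "finite F" "F \<subseteq> I" "x \<in> carrier M" "G \<subseteq> F" "a \<in> G \<rightarrow> carrier A"
  shows "inprod M (x \<ominus>\<^bsub>M\<^esub> proj e F x) (finsum M (\<lambda>i. ract M (e i) (a i)) G) = \<zero>\<^bsub>A\<^esub>"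
proof -
  have "finite G" "G \<subseteq> I"
    using assms finite_subset by auto
  then have "inprod M (x \<ominus>\<^bsub>M\<^esub> proj e F x) (finsum M (\<lambda>i. ract M (e i) (a i)) G)
      = finsum A (\<lambda>i. inprod M (x \<ominus>\<^bsub>M\<^esub> proj e F x) (e i) \<otimes>\<^bsub>A\<^esub> a i) G"
    using assms by (intro inprod_combination) auto
  also have "\<dots> = finsum A (\<lambda>i. \<zero>\<^bsub>A\<^esub>) G"
    using assms by (intro finsum_cong') (auto simp: Pi_iff subset_iff inprod_residual_e)
  finally show ?thesis
    by simp
qed

text \<open>
  \<open>x - y\<close> is the sum of the orthogonal vectors \<open>x - P\<^sub>F x\<close> and \<open>P\<^sub>F x - y\<close>, where \<open>P\<^sub>F\<close> is the
  projection onto the span of \<open>F\<close>.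
\<close>
lemma residual_le_approximation:
  assumes F: "finite F" "F \<subseteq> I" and x: "x \<in> carrier M" and G: "G \<subseteq> F" and a: "a \<in> G \<rightarrow> carrier A"
  shows "hnorm A M (x \<ominus>\<^bsub>M\<^esub> proj e F x)
    \<le> hnorm A M (x \<ominus>\<^bsub>M\<^esub> finsum M (\<lambda>i. ract M (e i) (a i)) G)"
proof -
  let ?p = "proj e F x" and ?y = "finsum M (\<lambda>i. ract M (e i) (a i)) G"
  have p: "?p \<in> carrier M" and y: "?y \<in> carrier M"
    using assms by auto
  have "inprod M (x \<ominus>\<^bsub>M\<^esub> ?p) ?p = \<zero>\<^bsub>A\<^esub>"
    using inprod_residual_combination[OF F x subset_refl, of "\<lambda>i. inprod M (e i) x"] F x
    by (auto simp: proj_def)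
  then have "inprod M (x \<ominus>\<^bsub>M\<^esub> ?p) (?p \<ominus>\<^bsub>M\<^esub> ?y) = \<zero>\<^bsub>A\<^esub>"
    using inprod_residual_combination[OF F x G a] p y x by (simp add: inprod_minus_right minus_eq r_neg)
  then have "hnorm A M (x \<ominus>\<^bsub>M\<^esub> ?p) \<le> hnorm A M ((x \<ominus>\<^bsub>M\<^esub> ?p) \<oplus>\<^bsub>M\<^esub> (?p \<ominus>\<^bsub>M\<^esub> ?y))"
    using p y x by (intro hnorm_le_hnorm_add) auto
  also have "(x \<ominus>\<^bsub>M\<^esub> ?p) \<oplus>\<^bsub>M\<^esub> (?p \<ominus>\<^bsub>M\<^esub> ?y) = x \<ominus>\<^bsub>M\<^esub> ?y"
    using p y x by (simp add: V.minus_eq V.a_assoc V.r_neg1)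
  finally show ?thesis .
qed

text \<open>
  Bessel's identity: as \<open>x - P\<^sub>F x\<close> is orthogonal to \<open>P\<^sub>F x\<close>, one of the two factors can be replaced by \<open>x\<close>.
\<close>
lemma inprod_residual:
  assumes F: "finite F" "F \<subseteq> I" and x: "x \<in> carrier M"
  shows "inprod M (x \<ominus>\<^bsub>M\<^esub> proj e F x) (x \<ominus>\<^bsub>M\<^esub> proj e F x)
    = inprod M x x \<ominus>\<^bsub>A\<^esub> finsum A (\<lambda>i. inprod M x (e i) \<otimes>\<^bsub>A\<^esub> inprod M (e i) x) F"
proof -
  let ?p = "proj e F x"
  have p: "?p \<in> carrier M"
    using assms by auto
  have "inprod M (x \<ominus>\<^bsub>M\<^esub> ?p) ?p = \<zero>\<^bsub>A\<^esub>"
    using inprod_residual_combination[OF F x subset_refl, of "\<lambda>i. inprod M (e i) x"] F x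
    by (auto simp: proj_def)
  then have "inprod M ?p (x \<ominus>\<^bsub>M\<^esub> ?p) = \<zero>\<^bsub>A\<^esub>"
    by (rule inprod_eq_zero_commute[rotated 2]) (use p x in auto)
  then have "inprod M (x \<ominus>\<^bsub>M\<^esub> ?p) (x \<ominus>\<^bsub>M\<^esub> ?p) = inprod M x (x \<ominus>\<^bsub>M\<^esub> ?p)"
    using p x inprod_minus_left[of x ?p "x \<ominus>\<^bsub>M\<^esub> ?p"] by (simp add: minus_eq)
  also have "\<dots> = inprod M x x \<ominus>\<^bsub>A\<^esub> inprod M x ?p"
    using p x by (simp add: inprod_minus_right)
  also have "inprod M x ?p = finsum A (\<lambda>i. inprod M x (e i) \<otimes>\<^bsub>A\<^esub> inprod M (e i) x) F"
    unfolding proj_def using F x by (intro inprod_combination) auto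
  finally show ?thesis .
qed

text \<open>
  Since \<open>\<langle>e\<^sub>i, e\<^sub>i\<rangle> = 1\<close>, the summand reduces to \<open>\<langle>x, e\<^sub>i\<rangle> \<langle>e\<^sub>i, x\<rangle>\<close>, so Bessel's identity identifies the
  error of the partial sum over \<open>F\<close> with \<open>\<parallel>x - P\<^sub>F x\<parallel>\<^sup>2\<close>.
\<close>
lemma has_norm_sum_c3_iff:
  assumes x: "x \<in> carrier M"
  shows "has_norm_sum A (anorm A)
      (\<lambda>i. (2 \<odot>\<^bsub>A\<^esub> (inprod M x (e i) \<otimes>\<^bsub>A\<^esub> inprod M (e i) x)) \<ominus>\<^bsub>A\<^esub>
           (inprod M x (e i) \<otimes>\<^bsub>A\<^esub> inprod M (e i) (e i) \<otimes>\<^bsub>A\<^esub> inprod M (e i) x))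
      I (inprod M x x) \<longleftrightarrow>
    ((\<lambda>F. hnorm A M (x \<ominus>\<^bsub>M\<^esub> proj e F x)) \<longlongrightarrow> 0) (finite_subsets_at_top I)"
    (is "has_norm_sum A (anorm A) ?t I _ \<longleftrightarrow> _")
proof -
  have t: "?t i = inprod M x (e i) \<otimes>\<^bsub>A\<^esub> inprod M (e i) x" if "i \<in> I" for i
  proof -
    define p where "p = inprod M x (e i) \<otimes>\<^bsub>A\<^esub> inprod M (e i) x"
    have p: "p \<in> carrier A"
      using that x by (simp add: p_def)
    have "inprod M x (e i) \<otimes>\<^bsub>A\<^esub> inprod M (e i) (e i) \<otimes>\<^bsub>A\<^esub> inprod M (e i) x = p"
      using that x by (simp add: p_def inprod_e)
    moreover have "2 \<odot>\<^bsub>A\<^esub> p \<ominus>\<^bsub>A\<^esub> p = p"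
      using p smult_add_left[of p 1 1] by (simp add: minus_eq a_assoc r_neg)
    ultimately show ?thesis
      by (simp only: p_def)
  qed
  have sq: "anorm A (finsum A ?t F \<ominus>\<^bsub>A\<^esub> inprod M x x) = (hnorm A M (x \<ominus>\<^bsub>M\<^esub> proj e F x))\<^sup>2"
    if F: "finite F" "F \<subseteq> I" for F
  proof -
    let ?u = "x \<ominus>\<^bsub>M\<^esub> proj e F x"
    define S where "S = finsum A (\<lambda>i. inprod M x (e i) \<otimes>\<^bsub>A\<^esub> inprod M (e i) x) F"
    have S: "S \<in> carrier A"
      unfolding S_def using F x by (intro finsum_closed) auto
    have "finsum A ?t F = S"
      unfolding S_def using F x by (intro finsum_cong') (auto simp: t subset_iff)
    then have "anorm A (finsum A ?t F \<ominus>\<^bsub>A\<^esub> inprod M x x) = anorm A (S \<ominus>\<^bsub>A\<^esub> inprod M x x)"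
      by (simp only:)
    also have "\<dots> = anorm A (inprod M x x \<ominus>\<^bsub>A\<^esub> S)"
      using S x by (intro anorm_minus_commute) auto
    also have "inprod M x x \<ominus>\<^bsub>A\<^esub> S = inprod M ?u ?u"
      unfolding S_def using inprod_residual[OF F x] by (simp only:)
    also have "anorm A (inprod M ?u ?u) = (hnorm A M ?u)\<^sup>2"
    proof -
      have "inprod M ?u ?u \<in> carrier A"
        using F x by (intro inprod_closed V.minus_closed proj_closed)
      then show ?thesis
        by (simp only: hnorm_def real_sqrt_pow2 anorm_nonneg)
    qed
    finally show ?thesis .
  qed
  have "has_norm_sum A (anorm A) ?t I (inprod M x x) \<longleftrightarrow>
    ((\<lambda>F. (hnorm A M (x \<ominus>\<^bsub>M\<^esub> proj e F x))\<^sup>2) \<longlongrightarrow> 0) (finite_subsets_at_top I)"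
    unfolding has_norm_sum_def
    by (rule tendsto_cong, rule eventually_finite_subsets_at_top_weakI, rule sq)
  also have "\<dots> \<longleftrightarrow> ((\<lambda>F. hnorm A M (x \<ominus>\<^bsub>M\<^esub> proj e F x)) \<longlongrightarrow> 0) (finite_subsets_at_top I)"
  proof
    assume "((\<lambda>F. (hnorm A M (x \<ominus>\<^bsub>M\<^esub> proj e F x))\<^sup>2) \<longlongrightarrow> 0) (finite_subsets_at_top I)"
    from tendsto_real_sqrt[OF this]
    show "((\<lambda>F. hnorm A M (x \<ominus>\<^bsub>M\<^esub> proj e F x)) \<longlongrightarrow> 0) (finite_subsets_at_top I)"
      by (simp only: real_sqrt_abs real_sqrt_zero tendsto_rabs_zero_iff)
  next
    assume "((\<lambda>F. hnorm A M (x \<ominus>\<^bsub>M\<^esub> proj e F x)) \<longlongrightarrow> 0) (finite_subsets_at_top I)"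
    from tendsto_power[OF this, of 2]
    show "((\<lambda>F. (hnorm A M (x \<ominus>\<^bsub>M\<^esub> proj e F x))\<^sup>2) \<longlongrightarrow> 0) (finite_subsets_at_top I)"
      by (simp only: zero_power2)
  qed
  finally show ?thesis .
qed

lemma cond_c3_iff:
  "cond_c3 A M I e \<longleftrightarrow> (\<forall>x\<in>carrier M.
    ((\<lambda>F. hnorm A M (x \<ominus>\<^bsub>M\<^esub> proj e F x)) \<longlongrightarrow> 0) (finite_subsets_at_top I))"
  unfolding cond_c3_def by (rule ball_cong[OF refl]) (erule has_norm_sum_c3_iff)

lemma c1_imp_c3:
  assumes "cond_c1 A M I e"
  shows "cond_c3 A M I e"
  unfolding cond_c3_iff
proof
  fix x assume x: "x \<in> carrier M"
  show "((\<lambda>F. hnorm A M (x \<ominus>\<^bsub>M\<^esub> proj e F x)) \<longlongrightarrow> 0) (finite_subsets_at_top I)"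
  proof (rule tendstoI)
    fix \<epsilon> :: real assume "0 < \<epsilon>"
    have "carrier M = norm_closure M (hnorm A M) (A_span A M I e)"
      using assms by (simp only: cond_c1_def)
    then have "x \<in> norm_closure M (hnorm A M) (A_span A M I e)"
      using x by blast
    then obtain y where "y \<in> A_span A M I e" and y: "hnorm A M (x \<ominus>\<^bsub>M\<^esub> y) < \<epsilon>"
      using \<open>0 < \<epsilon>\<close> unfolding norm_closure_def by blast
    then obtain G a where G: "finite G" "G \<subseteq> I" "a \<in> I \<rightarrow> carrier A"
      and y_eq: "y = finsum M (\<lambda>i. ract M (e i) (a i)) G"
      unfolding A_span_def by blast
    note close = y[unfolded y_eq]
    have aG: "a \<in> G \<rightarrow> carrier A"
      using G by auto
    have "dist (hnorm A M (x \<ominus>\<^bsub>M\<^esub> proj e F x)) 0 < \<epsilon>" if "finite F" "G \<subseteq> F" "F \<subseteq> I" for F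
    proof -
      have "hnorm A M (x \<ominus>\<^bsub>M\<^esub> proj e F x) < \<epsilon>"
        using residual_le_approximation[OF that(1,3) x that(2) aG] close by (rule order.strict_trans1)
      then show ?thesis
        using hnorm_nonneg[of "x \<ominus>\<^bsub>M\<^esub> proj e F x"] x that by auto
    qed
    then show "\<forall>\<^sub>F F in finite_subsets_at_top I. dist (hnorm A M (x \<ominus>\<^bsub>M\<^esub> proj e F x)) 0 < \<epsilon>"
      unfolding eventually_finite_subsets_at_top using G by blast
  qed
qed

text \<open>
  The Fourier coefficients \<open>a\<^sub>i = \<langle>e\<^sub>i, x\<rangle>\<close> serve.
\<close>
lemma c3_imp_c2:
  assumes "cond_c3 A M I e"
  shows "cond_c2 A M I e"
  unfolding cond_c2_def
proof
  fix x assume x: "x \<in> carrier M"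
  then have lim: "((\<lambda>F. hnorm A M (x \<ominus>\<^bsub>M\<^esub> proj e F x)) \<longlongrightarrow> 0) (finite_subsets_at_top I)"
    using assms by (simp only: cond_c3_iff)
  have eq: "\<forall>\<^sub>F F in finite_subsets_at_top I.
      hnorm A M (x \<ominus>\<^bsub>M\<^esub> proj e F x) = hnorm A M (proj e F x \<ominus>\<^bsub>M\<^esub> x)"
    using x by (intro eventually_finite_subsets_at_top_weakI hnorm_minus_commute) auto
  have "has_norm_sum M (hnorm A M) (\<lambda>i. ract M (e i) (inprod M (e i) x)) I x"
    using iffD1[OF tendsto_cong[OF eq] lim] unfolding has_norm_sum_def proj_def .
  then show "\<exists>a\<in>I \<rightarrow> carrier A. has_norm_sum M (hnorm A M) (\<lambda>i. ract M (e i) (a i)) I x"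
    using x by (intro bexI[of _ "\<lambda>i. inprod M (e i) x"]) auto
qed

lemma c2_imp_c1:
  assumes "cond_c2 A M I e"
  shows "cond_c1 A M I e"
proof -
  have "\<exists>y\<in>A_span A M I e. hnorm A M (x \<ominus>\<^bsub>M\<^esub> y) < \<epsilon>"
    if x: "x \<in> carrier M" and \<epsilon>: "0 < \<epsilon>" for x \<epsilon>
  proof -
    obtain a where a: "a \<in> I \<rightarrow> carrier A"
      and sum: "has_norm_sum M (hnorm A M) (\<lambda>i. ract M (e i) (a i)) I x"
      using assms x unfolding cond_c2_def by blast
    have "\<forall>\<^sub>F F in finite_subsets_at_top I.
        hnorm A M (finsum M (\<lambda>i. ract M (e i) (a i)) F \<ominus>\<^bsub>M\<^esub> x) < \<epsilon>"
      using sum \<epsilon> unfolding has_norm_sum_def by (rule order_tendstoD)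
    then obtain F where F: "finite F" "F \<subseteq> I"
      and "hnorm A M (finsum M (\<lambda>i. ract M (e i) (a i)) F \<ominus>\<^bsub>M\<^esub> x) < \<epsilon>"
      unfolding eventually_finite_subsets_at_top by blast
    moreover have "finsum M (\<lambda>i. ract M (e i) (a i)) F \<in> carrier M"
      using F a by (intro combination_closed) auto
    moreover have "finsum M (\<lambda>i. ract M (e i) (a i)) F \<in> A_span A M I e"
      using F a unfolding A_span_def by blast
    ultimately show ?thesis
      using x by (intro bexI) (simp_all add: hnorm_minus_commute[of x])
  qed
  then show ?thesis
    by (auto simp: cond_c1_def norm_closure_def)
qed

lemma c3_imp_c4:
  assumes "cond_c3 A M I e"
  shows "cond_c4 A M I e"
  unfolding cond_c4_def
proof safe
  fix x assume x: "x \<in> carrier M" and nz: "x \<noteq> \<zero>\<^bsub>M\<^esub>" and orth: "\<forall>i\<in>I. inprod M (e i) x = \<zero>\<^bsub>A\<^esub>"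
  have lim: "((\<lambda>F. hnorm A M (x \<ominus>\<^bsub>M\<^esub> proj e F x)) \<longlongrightarrow> 0) (finite_subsets_at_top I)"
    using assms x by (simp only: cond_c3_iff)
  have "hnorm A M (x \<ominus>\<^bsub>M\<^esub> proj e F x) = hnorm A M x" if F: "finite F" "F \<subseteq> I" for F
  proof -
    have "finsum A (\<lambda>i. inprod M x (e i) \<otimes>\<^bsub>A\<^esub> inprod M (e i) x) F = finsum A (\<lambda>i. \<zero>\<^bsub>A\<^esub>) F"
      using F orth x by (intro finsum_cong') (auto simp: subset_iff)
    then show ?thesis
      using inprod_residual[OF F x] x by (simp add: hnorm_def minus_eq)
  qed
  then have eq: "\<forall>\<^sub>F F in finite_subsets_at_top I. hnorm A M (x \<ominus>\<^bsub>M\<^esub> proj e F x) = hnorm A M x"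
    by (rule eventually_finite_subsets_at_top_weakI)
  have "((\<lambda>F. hnorm A M x) \<longlongrightarrow> 0) (finite_subsets_at_top I)"
    using iffD1[OF tendsto_cong[OF eq] lim] .
  then have "hnorm A M x = 0"
    by (simp add: tendsto_const_iff)
  then have "inprod M x x = \<zero>\<^bsub>A\<^esub>"
    using x by (simp add: hnorm_def anorm_eq_0_iff)
  with inprod_definite x nz show False
    by blast
qed

lemma c1_iff_c2: "cond_c1 A M I e \<longleftrightarrow> cond_c2 A M I e"
  using c1_imp_c3 c3_imp_c2 c2_imp_c1 by blast

lemma c2_iff_c3: "cond_c2 A M I e \<longleftrightarrow> cond_c3 A M I e"
  using c1_imp_c3 c3_imp_c2 c2_imp_c1 by blast

end

end

section \<open>Bounded sequences of square-summable sequences\<close>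

lemma complex_field_simps [simp]:
  "carrier complex_field = UNIV" "c \<otimes>\<^bsub>complex_field\<^esub> d = c * d" "\<one>\<^bsub>complex_field\<^esub> = 1"
  "c \<oplus>\<^bsub>complex_field\<^esub> d = c + d" "\<zero>\<^bsub>complex_field\<^esub> = 0"
  by (simp_all add: complex_field_def)

lemma cring_complex_field: "cring complex_field"
proof (rule cringI)
  show "abelian_group complex_field"
    by (rule abelian_groupI) (auto simp: complex_field_def algebra_simps intro: exI[of _ "- _"])
  show "comm_monoid complex_field"
    by (rule comm_monoidI) (auto simp: complex_field_def)
qed (auto simp: complex_field_def algebra_simps)

definition linf :: "(nat \<Rightarrow> complex) star_algebra" where
  "linf = \<lparr>carrier = {f. \<exists>B. \<forall>n. cmod (f n) \<le> B},
     monoid.mult = \<lambda>f g n. f n * g n, one = \<lambda>n. 1, zero = \<lambda>n. 0, add = \<lambda>f g n. f n + g n,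
     smult = \<lambda>c f n. c * f n, star = \<lambda>f n. cnj (f n), anorm = \<lambda>f. SUP n. cmod (f n)\<rparr>"

lemma linf_simps [simp]:
  "f \<otimes>\<^bsub>linf\<^esub> g = (\<lambda>n. f n * g n)" "one linf = (\<lambda>n. 1)" "zero linf = (\<lambda>n. 0)"
  "add linf f g = (\<lambda>n. f n + g n)" "smult linf c f = (\<lambda>n. c * f n)" "star linf f = (\<lambda>n. cnj (f n))"
  by (simp_all add: linf_def)

lemma linf_iff: "f \<in> carrier linf \<longleftrightarrow> (\<exists>B. \<forall>n. cmod (f n) \<le> B)"
  by (simp add: linf_def)

lemma linfI: "(\<And>n. cmod (f n) \<le> B) \<Longrightarrow> f \<in> carrier linf"
  by (auto simp: linf_iff)

lemma cmod_le_anorm_linf: "f \<in> carrier linf \<Longrightarrow> cmod (f n) \<le> anorm linf f"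
  by (auto simp: linf_def intro!: cSUP_upper bdd_aboveI)

lemma anorm_linf_le: "(\<And>n. cmod (f n) \<le> B) \<Longrightarrow> anorm linf f \<le> B"
  by (auto simp: linf_def intro: cSUP_least)

lemma linf_add: "f \<in> carrier linf \<Longrightarrow> g \<in> carrier linf \<Longrightarrow> (\<lambda>n. f n + g n) \<in> carrier linf"
  by (rule linfI[of _ "anorm linf f + anorm linf g"])
    (blast intro: norm_triangle_mono cmod_le_anorm_linf)

lemma linf_mult: "f \<in> carrier linf \<Longrightarrow> g \<in> carrier linf \<Longrightarrow> (\<lambda>n. f n * g n) \<in> carrier linf"
  by (rule linfI[of _ "anorm linf f * anorm linf g"])
    (auto simp: norm_mult intro!: mult_mono' cmod_le_anorm_linf)

lemma linf_const: "(\<lambda>n. c) \<in> carrier linf"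
  by (rule linfI[of _ "cmod c"]) simp

lemma linf_smult: "f \<in> carrier linf \<Longrightarrow> (\<lambda>n. c * f n) \<in> carrier linf"
  using linf_mult[OF linf_const[of c]] .

lemma linf_abelian_group: "abelian_group linf"
proof (rule abelian_groupI)
  fix f assume "f \<in> carrier linf"
  then show "\<exists>g\<in>carrier linf. g \<oplus>\<^bsub>linf\<^esub> f = \<zero>\<^bsub>linf\<^esub>"
    using linf_smult[of f "-1"] by (intro bexI[of _ "\<lambda>n. - f n"]) auto
qed (auto simp: linf_add linf_const algebra_simps)

lemma linf_minus:
  assumes "f \<in> carrier linf" "g \<in> carrier linf"
  shows "f \<ominus>\<^bsub>linf\<^esub> g = (\<lambda>n. f n - g n)"
proof -
  interpret abelian_group linf
    by (rule linf_abelian_group)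
  have "\<ominus>\<^bsub>linf\<^esub> g = (\<lambda>n. - g n)"
    using assms(2) linf_smult[OF assms(2), of "-1"] by (intro minus_equality) auto
  then show ?thesis
    by (simp add: minus_eq)
qed

text \<open>
  The pointwise limit of a Cauchy sequence is its uniform limit: estimates between members of the
  sequence pass to the limit in one of the two indices.
\<close>
lemma norm_complete_linf: "norm_complete linf (anorm linf)"
  unfolding norm_complete_def
proof (intro allI impI)
  fix u :: "nat \<Rightarrow> nat \<Rightarrow> complex"
  assume "range u \<subseteq> carrier linf"
    and cauchy: "\<forall>\<epsilon>>0. \<exists>N. \<forall>m\<ge>N. \<forall>k\<ge>N. anorm linf (u m \<ominus>\<^bsub>linf\<^esub> u k) < \<epsilon>"
  then have u: "u m \<in> carrier linf" for m
    by auto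
  have minus_u: "u m \<ominus>\<^bsub>linf\<^esub> u k = (\<lambda>n. u m n - u k n)" for m k
    by (intro linf_minus u)
  have diff: "cmod (u m n - u k n) \<le> anorm linf (u m \<ominus>\<^bsub>linf\<^esub> u k)" for m k n
    using cmod_le_anorm_linf[of "\<lambda>n. u m n - u k n" n] linf_add[OF u linf_smult[OF u, of "-1"]]
    by (simp add: minus_u)
  have "Cauchy (\<lambda>k. u k n)" for n
    unfolding Cauchy_iff using cauchy diff by (meson order.strict_trans1)
  then have "\<exists>l. \<forall>n. (\<lambda>k. u k n) \<longlonglongrightarrow> l n"
    by (intro choice) (simp add: Cauchy_convergent_iff convergent_def)
  then obtain l where l: "\<And>n. (\<lambda>k. u k n) \<longlonglongrightarrow> l n"
    by blast
  have uniform: "\<exists>N. \<forall>m\<ge>N. \<forall>n. cmod (u m n - l n) \<le> \<epsilon>" if \<epsilon>: "0 < \<epsilon>" for \<epsilon>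
  proof -
    obtain N where N: "\<And>m k. N \<le> m \<Longrightarrow> N \<le> k \<Longrightarrow> anorm linf (u m \<ominus>\<^bsub>linf\<^esub> u k) < \<epsilon>"
      using cauchy \<epsilon> by blast
    have "cmod (u m n - l n) \<le> \<epsilon>" if "N \<le> m" for m n
    proof (rule LIMSEQ_le_const2)
      show "(\<lambda>k. cmod (u m n - u k n)) \<longlonglongrightarrow> cmod (u m n - l n)"
        by (intro tendsto_intros l)
      show "\<exists>N. \<forall>k\<ge>N. cmod (u m n - u k n) \<le> \<epsilon>"
        using N[OF that] diff[of m n] by (meson le_less_trans less_imp_le)
    qed
    then show ?thesis
      by blast
  qed
  obtain N where N: "\<And>n. cmod (u N n - l n) \<le> 1"
    using uniform[of 1] by auto
  have lc: "l \<in> carrier linf"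
  proof (rule linfI)
    show "cmod (l n) \<le> anorm linf (u N) + 1" for n
      using norm_triangle_ineq4[of "u N n" "u N n - l n"] cmod_le_anorm_linf[OF u, of N n] N[of n]
      by simp
  qed
  have "(\<lambda>m. anorm linf (u m \<ominus>\<^bsub>linf\<^esub> l)) \<longlonglongrightarrow> 0"
  proof (rule LIMSEQ_I)
    fix \<epsilon> :: real assume "0 < \<epsilon>"
    then obtain N where N: "\<And>m n. N \<le> m \<Longrightarrow> cmod (u m n - l n) \<le> \<epsilon> / 2"
      using uniform[of "\<epsilon> / 2"] by auto
    have "norm (anorm linf (u m \<ominus>\<^bsub>linf\<^esub> l) - 0) < \<epsilon>" if "N \<le> m" for m
    proof -
      have "anorm linf (\<lambda>n. u m n - l n) \<le> \<epsilon> / 2"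
        using N[OF that] by (rule anorm_linf_le)
      moreover have "0 \<le> anorm linf (\<lambda>n. u m n - l n)"
        using cmod_le_anorm_linf[of "\<lambda>n. u m n - l n" 0] linf_add[OF u linf_smult[OF lc, of "-1"]]
        by (auto intro: order_trans[OF norm_ge_zero])
      ultimately show ?thesis
        using \<open>0 < \<epsilon>\<close> by (simp add: linf_minus u lc)
    qed
    then show "\<exists>N. \<forall>m\<ge>N. norm (anorm linf (u m \<ominus>\<^bsub>linf\<^esub> l) - 0) < \<epsilon>"
      by blast
  qed
  with lc show "\<exists>l\<in>carrier linf. (\<lambda>m. anorm linf (u m \<ominus>\<^bsub>linf\<^esub> l)) \<longlonglongrightarrow> 0"
    by blast
qed

lemma anorm_linf_nonneg: "f \<in> carrier linf \<Longrightarrow> 0 \<le> anorm linf f"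
  using order_trans[OF norm_ge_zero cmod_le_anorm_linf] .

lemma linf_unital_cstar_algebra: "unital_cstar_algebra linf"
proof (rule unital_cstar_algebra.intro)
  show "Ring.ring linf"
  proof (rule ringI)
    show "Group.monoid linf"
      by (rule monoidI) (auto simp: linf_mult linf_const)
  qed (auto simp: linf_abelian_group algebra_simps)
  show "Module.module complex_field linf"
    by (rule moduleI)
      (auto simp: cring_complex_field linf_abelian_group linf_smult algebra_simps)
next
  fix f assume f: "f \<in> carrier linf"
  show "star linf f \<in> carrier linf"
    using f by (simp add: linf_iff)
  show "0 \<le> anorm linf f"
    using f by (rule anorm_linf_nonneg)
  show "anorm linf f = 0 \<longleftrightarrow> f = \<zero>\<^bsub>linf\<^esub>"
  proof
    assume "anorm linf f = 0"
    then show "f = \<zero>\<^bsub>linf\<^esub>"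
      using cmod_le_anorm_linf[OF f] by (auto simp: fun_eq_iff)
  qed (simp add: linf_def)
  show "anorm linf (c \<odot>\<^bsub>linf\<^esub> f) = cmod c * anorm linf f" for c
  proof (rule antisym)
    show "anorm linf (c \<odot>\<^bsub>linf\<^esub> f) \<le> cmod c * anorm linf f"
      using cmod_le_anorm_linf[OF f] by (intro anorm_linf_le) (auto simp: norm_mult intro!: mult_left_mono)
    show "cmod c * anorm linf f \<le> anorm linf (c \<odot>\<^bsub>linf\<^esub> f)"
    proof (cases "c = 0")
      case False
      have "anorm linf f \<le> anorm linf (c \<odot>\<^bsub>linf\<^esub> f) / cmod c"
        using cmod_le_anorm_linf[OF linf_smult[OF f, of c]] False
        by (intro anorm_linf_le) (auto simp: norm_mult field_simps)
      then show ?thesis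
        using False by (simp add: field_simps)
    qed (simp add: linf_def)
  qed
  show "anorm linf (star linf f \<otimes>\<^bsub>linf\<^esub> f) = (anorm linf f)\<^sup>2"
  proof (rule antisym)
    show "anorm linf (star linf f \<otimes>\<^bsub>linf\<^esub> f) \<le> (anorm linf f)\<^sup>2"
      using cmod_le_anorm_linf[OF f]
      by (intro anorm_linf_le) (auto simp: norm_mult power2_eq_square intro!: mult_mono')
    have "star linf f \<otimes>\<^bsub>linf\<^esub> f \<in> carrier linf"
      using f linf_mult[of "star linf f" f] by (simp add: linf_iff)
    note b = cmod_le_anorm_linf[OF this]
    have "anorm linf f \<le> sqrt (anorm linf (star linf f \<otimes>\<^bsub>linf\<^esub> f))"
      using b by (intro anorm_linf_le real_le_rsqrt) (simp add: norm_mult power2_eq_square)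
    then have "(anorm linf f)\<^sup>2 \<le> (sqrt (anorm linf (star linf f \<otimes>\<^bsub>linf\<^esub> f)))\<^sup>2"
      using anorm_linf_nonneg[OF f] by (intro power_mono)
    also have "\<dots> = anorm linf (star linf f \<otimes>\<^bsub>linf\<^esub> f)"
      using order_trans[OF norm_ge_zero b[of 0]] by simp
    finally show "(anorm linf f)\<^sup>2 \<le> anorm linf (star linf f \<otimes>\<^bsub>linf\<^esub> f)" .
  qed
  fix g assume g: "g \<in> carrier linf"
  show "anorm linf (f \<oplus>\<^bsub>linf\<^esub> g) \<le> anorm linf f + anorm linf g"
    using f g by (intro anorm_linf_le) (auto intro: norm_triangle_mono cmod_le_anorm_linf)
  show "anorm linf (f \<otimes>\<^bsub>linf\<^esub> g) \<le> anorm linf f * anorm linf g"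
    using f g by (intro anorm_linf_le) (auto simp: norm_mult intro!: mult_mono' cmod_le_anorm_linf)
qed (auto simp: norm_complete_linf algebra_simps)

text \<open>
  A complex number outside the closed half-line \<open>[0, \<infinity>)\<close> has positive distance from it, which bounds
  the pointwise inverse of \<open>c - f\<close>.
\<close>
lemma positive_linfI:
  assumes f: "f \<in> carrier linf" and nonneg: "\<And>n. f n \<in> \<real>\<^sub>\<ge>\<^sub>0"
  shows "positive linf f"
  unfolding positive_def
proof (intro conjI subsetI)
  have "cnj (f n) = f n" for n
    using nonneg[of n] by (auto simp: nonneg_Reals_def)
  then show "star linf f = f"
    by (simp add: fun_eq_iff)
  fix c assume c: "c \<in> spectrum linf f"
  show "c \<in> \<real>\<^sub>\<ge>\<^sub>0"
  proof (rule ccontr)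
    assume "c \<notin> \<real>\<^sub>\<ge>\<^sub>0"
    then obtain \<delta> where \<delta>: "0 < \<delta>" and away: "\<And>z. z \<in> \<real>\<^sub>\<ge>\<^sub>0 \<Longrightarrow> \<delta> \<le> cmod (c - z)"
      using closed_nonneg_Reals_complex
      by (metis closed_def openE Compl_iff dist_norm mem_ball not_le subsetD)
    have le: "\<delta> \<le> cmod (c - f n)" for n
      using away nonneg by simp
    then have nz: "c - f n \<noteq> 0" for n
      using \<delta> by (metis norm_zero not_le)
    have inv: "(\<lambda>n. 1 / (c - f n)) \<in> carrier linf"
      using le \<delta> by (intro linfI[of _ "1 / \<delta>"]) (auto simp: norm_divide intro!: frac_le)
    have "c \<odot>\<^bsub>linf\<^esub> \<one>\<^bsub>linf\<^esub> \<ominus>\<^bsub>linf\<^esub> f = (\<lambda>n. c - f n)"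
      using linf_minus[OF linf_const f] by simp
    moreover have "(\<lambda>n. c - f n) \<in> carrier linf"
      using linf_add[OF linf_const linf_smult[OF f, of "-1"]] by simp
    ultimately have "c \<odot>\<^bsub>linf\<^esub> \<one>\<^bsub>linf\<^esub> \<ominus>\<^bsub>linf\<^esub> f \<in> Units linf"
      using inv nz unfolding Units_def by (auto intro!: bexI[of _ "\<lambda>n. 1 / (c - f n)"])
    then show False
      using c by (simp add: spectrum_def)
  qed
qed (rule f)

text \<open>
  The bounded sequences of vectors in \<open>\<ell>\<^sup>2\<close>, where \<open>x n i\<close> is the \<open>i\<close>-th coordinate of the \<open>n\<close>-th
  vector. Boundedness is expressed by partial sums, which yields summability at the same time.
\<close>
definition l2_fields :: "(nat \<Rightarrow> nat \<Rightarrow> complex, nat \<Rightarrow> complex) inner_module" where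
  "l2_fields = \<lparr>carrier = {x. \<exists>B. \<forall>n N. (\<Sum>i<N. (cmod (x n i))\<^sup>2) \<le> B},
     monoid.mult = undefined, one = undefined,
     zero = \<lambda>n i. 0, add = \<lambda>x y n i. x n i + y n i, smult = \<lambda>c x n i. c * x n i,
     ract = \<lambda>x f n i. x n i * f n, inprod = \<lambda>x y n. \<Sum>i. cnj (x n i) * y n i\<rparr>"

lemma l2_fields_simps [simp]:
  "\<zero>\<^bsub>l2_fields\<^esub> = (\<lambda>n i. 0)" "x \<oplus>\<^bsub>l2_fields\<^esub> y = (\<lambda>n i. x n i + y n i)"
  "c \<odot>\<^bsub>l2_fields\<^esub> x = (\<lambda>n i. c * x n i)" "ract l2_fields x f = (\<lambda>n i. x n i * f n)"
  "inprod l2_fields x y = (\<lambda>n. \<Sum>i. cnj (x n i) * y n i)"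
  by (simp_all add: l2_fields_def)

lemma l2_fields_iff: "x \<in> carrier l2_fields \<longleftrightarrow> (\<exists>B. \<forall>n N. (\<Sum>i<N. (cmod (x n i))\<^sup>2) \<le> B)"
  by (simp add: l2_fields_def)

lemma l2_fieldsI: "(\<And>n N. (\<Sum>i<N. (cmod (x n i))\<^sup>2) \<le> B) \<Longrightarrow> x \<in> carrier l2_fields"
  by (auto simp: l2_fields_iff)

text \<open>
  Compare with the sum of squares: \<open>\<bar>a b\<bar> \<le> (\<bar>a\<bar>\<^sup>2 + \<bar>b\<bar>\<^sup>2) / 2\<close>.
\<close>
lemma l2_product:
  fixes a b :: "nat \<Rightarrow> complex"
  assumes a: "\<And>N. (\<Sum>i<N. (cmod (a i))\<^sup>2) \<le> B" and b: "\<And>N. (\<Sum>i<N. (cmod (b i))\<^sup>2) \<le> C"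
  shows "summable (\<lambda>i. cnj (a i) * b i)" "cmod (\<Sum>i. cnj (a i) * b i) \<le> (B + C) / 2"
proof -
  have partial: "(\<Sum>i<N. cmod (cnj (a i) * b i)) \<le> (B + C) / 2" for N
  proof -
    have "cmod (cnj (a i) * b i) \<le> ((cmod (a i))\<^sup>2 + (cmod (b i))\<^sup>2) / 2" for i
      using sum_squares_bound[of "cmod (a i)" "cmod (b i)"] by (simp add: norm_mult)
    then have "(\<Sum>i<N. cmod (cnj (a i) * b i)) \<le> (\<Sum>i<N. ((cmod (a i))\<^sup>2 + (cmod (b i))\<^sup>2) / 2)"
      by (intro sum_mono)
    also have "\<dots> = ((\<Sum>i<N. (cmod (a i))\<^sup>2) + (\<Sum>i<N. (cmod (b i))\<^sup>2)) / 2"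
      by (simp add: sum.distrib flip: sum_divide_distrib)
    finally show ?thesis
      using a[of N] b[of N] by simp
  qed
  then have abs: "summable (\<lambda>i. cmod (cnj (a i) * b i))"
    by (intro summableI_nonneg_bounded[of _ "(B + C) / 2"]) auto
  then show "summable (\<lambda>i. cnj (a i) * b i)"
    by (rule summable_norm_cancel)
  show "cmod (\<Sum>i. cnj (a i) * b i) \<le> (B + C) / 2"
    using summable_norm[OF abs] suminf_le_const[OF abs partial] by simp
qed

lemma inprod_summable:
  assumes "x \<in> carrier l2_fields" "y \<in> carrier l2_fields"
  shows "summable (\<lambda>i. cnj (x n i) * y n i)"
proof -
  obtain B where B: "\<And>N. (\<Sum>i<N. (cmod (x n i))\<^sup>2) \<le> B"
    using assms(1) by (auto simp: l2_fields_iff)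
  obtain C where C: "\<And>N. (\<Sum>i<N. (cmod (y n i))\<^sup>2) \<le> C"
    using assms(2) by (auto simp: l2_fields_iff)
  show ?thesis
    using B C by (rule l2_product(1))
qed

lemma inprod_linf:
  assumes "x \<in> carrier l2_fields" "y \<in> carrier l2_fields"
  shows "(\<lambda>n. \<Sum>i. cnj (x n i) * y n i) \<in> carrier linf"
proof -
  obtain B C where "\<And>n N. (\<Sum>i<N. (cmod (x n i))\<^sup>2) \<le> B" "\<And>n N. (\<Sum>i<N. (cmod (y n i))\<^sup>2) \<le> C"
    using assms by (auto simp: l2_fields_iff)
  then show ?thesis
    using l2_product(2) by (intro linfI) blast
qed

lemma cnj_mult_self: "cnj z * z = complex_of_real ((cmod z)\<^sup>2)"
  by (simp only: complex_norm_square mult.commute)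

lemma norm_square_summable:
  assumes "x \<in> carrier l2_fields"
  shows "summable (\<lambda>i. (cmod (x n i))\<^sup>2)"
proof -
  obtain B where "\<And>N. (\<Sum>i<N. (cmod (x n i))\<^sup>2) \<le> B"
    using assms by (auto simp: l2_fields_iff)
  then show ?thesis
    by (intro summableI_nonneg_bounded[of _ B]) auto
qed

lemma inprod_self:
  assumes "x \<in> carrier l2_fields"
  shows "(\<Sum>i. cnj (x n i) * x n i) = complex_of_real (\<Sum>i. (cmod (x n i))\<^sup>2)"
  unfolding cnj_mult_self by (rule suminf_of_real[OF norm_square_summable[OF assms], symmetric])

lemma l2_fields_add:
  assumes "x \<in> carrier l2_fields" "y \<in> carrier l2_fields"
  shows "(\<lambda>n i. x n i + y n i) \<in> carrier l2_fields"
proof -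
  obtain B C where B: "\<And>n N. (\<Sum>i<N. (cmod (x n i))\<^sup>2) \<le> B" and C: "\<And>n N. (\<Sum>i<N. (cmod (y n i))\<^sup>2) \<le> C"
    using assms by (auto simp: l2_fields_iff)
  show ?thesis
  proof (rule l2_fieldsI)
    fix n N
    have "(cmod (x n i + y n i))\<^sup>2 \<le> 2 * (cmod (x n i))\<^sup>2 + 2 * (cmod (y n i))\<^sup>2" for i
    proof -
      have "(cmod (x n i + y n i))\<^sup>2 \<le> (cmod (x n i) + cmod (y n i))\<^sup>2"
        by (intro power_mono norm_triangle_ineq) auto
      then show ?thesis
        using sum_squares_bound[of "cmod (x n i)" "cmod (y n i)"] by (simp add: power2_sum)
    qed
    then have "(\<Sum>i<N. (cmod (x n i + y n i))\<^sup>2)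
        \<le> (\<Sum>i<N. 2 * (cmod (x n i))\<^sup>2 + 2 * (cmod (y n i))\<^sup>2)"
      by (intro sum_mono)
    also have "\<dots> = 2 * (\<Sum>i<N. (cmod (x n i))\<^sup>2) + 2 * (\<Sum>i<N. (cmod (y n i))\<^sup>2)"
      by (simp add: sum.distrib sum_distrib_left)
    finally show "(\<Sum>i<N. (cmod (x n i + y n i))\<^sup>2) \<le> 2 * B + 2 * C"
      using B[of n N] C[of n N] by linarith
  qed
qed

lemma l2_fields_ract:
  assumes x: "x \<in> carrier l2_fields" and f: "f \<in> carrier linf"
  shows "(\<lambda>n i. x n i * f n) \<in> carrier l2_fields"
proof -
  obtain B where B: "\<And>n N. (\<Sum>i<N. (cmod (x n i))\<^sup>2) \<le> B"
    using x by (auto simp: l2_fields_iff)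
  show ?thesis
  proof (rule l2_fieldsI)
    fix n N
    have "(\<Sum>i<N. (cmod (x n i * f n))\<^sup>2) = (\<Sum>i<N. (cmod (x n i))\<^sup>2) * (cmod (f n))\<^sup>2"
      by (simp add: norm_mult power_mult_distrib sum_distrib_right)
    also have "\<dots> \<le> B * (anorm linf f)\<^sup>2"
      using B[of n N] cmod_le_anorm_linf[OF f, of n] order_trans[OF sum_nonneg B[of n N]]
      by (intro mult_mono power_mono) auto
    finally show "(\<Sum>i<N. (cmod (x n i * f n))\<^sup>2) \<le> B * (anorm linf f)\<^sup>2" .
  qed
qed

lemma l2_fields_smult:
  "x \<in> carrier l2_fields \<Longrightarrow> (\<lambda>n i. c * x n i) \<in> carrier l2_fields"
  using l2_fields_ract[OF _ linf_const[of c]] by (simp add: mult.commute)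

lemma l2_fields_zero: "(\<lambda>n i. 0) \<in> carrier l2_fields"
  by (rule l2_fieldsI[of _ 0]) simp

lemma l2_fields_abelian_group: "abelian_group l2_fields"
proof (rule abelian_groupI)
  fix x assume "x \<in> carrier l2_fields"
  then show "\<exists>y\<in>carrier l2_fields. y \<oplus>\<^bsub>l2_fields\<^esub> x = \<zero>\<^bsub>l2_fields\<^esub>"
    using l2_fields_smult[of x "-1"] by (intro bexI[of _ "\<lambda>n i. - x n i"]) auto
qed (auto simp: l2_fields_add l2_fields_zero algebra_simps)

lemma l2_fields_minus:
  assumes "x \<in> carrier l2_fields" "y \<in> carrier l2_fields"
  shows "x \<ominus>\<^bsub>l2_fields\<^esub> y = (\<lambda>n i. x n i - y n i)"
proof -
  interpret abelian_group l2_fields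
    by (rule l2_fields_abelian_group)
  have "\<ominus>\<^bsub>l2_fields\<^esub> y = (\<lambda>n i. - y n i)"
    using assms(2) l2_fields_smult[OF assms(2), of "-1"] by (intro minus_equality) auto
  then show ?thesis
    by (simp add: minus_eq)
qed

lemma l2_fields_diff:
  assumes "x \<in> carrier l2_fields" "y \<in> carrier l2_fields"
  shows "(\<lambda>n i. x n i - y n i) \<in> carrier l2_fields"
  using l2_fields_add[OF assms(1) l2_fields_smult[OF assms(2), of "-1"]] by simp

lemma sum_le_hnorm_square:
  assumes x: "x \<in> carrier l2_fields"
  shows "(\<Sum>i<N. (cmod (x n i))\<^sup>2) \<le> (hnorm linf l2_fields x)\<^sup>2"
proof -
  have "(\<Sum>i<N. (cmod (x n i))\<^sup>2) \<le> (\<Sum>i. (cmod (x n i))\<^sup>2)"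
    using norm_square_summable[OF x] by (intro sum_le_suminf) auto
  also have "\<dots> \<le> cmod (\<Sum>i. cnj (x n i) * x n i)"
    unfolding inprod_self[OF x] by (simp only: norm_of_real abs_ge_self)
  also have "\<dots> \<le> anorm linf (inprod l2_fields x x)"
    using cmod_le_anorm_linf[OF inprod_linf[OF x x], of n] by simp
  finally have le: "(\<Sum>i<N. (cmod (x n i))\<^sup>2) \<le> anorm linf (inprod l2_fields x x)" .
  moreover have "0 \<le> anorm linf (inprod l2_fields x x)"
    using inprod_linf[OF x x] anorm_linf_nonneg by simp
  ultimately show ?thesis
    unfolding hnorm_def by (simp only: real_sqrt_pow2)
qed

lemma hnorm_le:
  assumes bound: "\<And>n N. (\<Sum>i<N. (cmod (x n i))\<^sup>2) \<le> B\<^sup>2" and B: "0 \<le> B"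
  shows "hnorm linf l2_fields x \<le> B"
proof -
  have "anorm linf (inprod l2_fields x x) \<le> B\<^sup>2"
    using l2_product(2)[OF bound bound] by (intro anorm_linf_le) simp
  then show ?thesis
    using B by (simp add: hnorm_def real_le_lsqrt)
qed

text \<open>
  As for \<open>\<ell>\<^sup>\<infinity>\<close>, with the partial sums of squares in place of the absolute values: each of them
  involves finitely many coordinates only, so it passes to the coordinatewise limit.
\<close>
lemma norm_complete_l2_fields: "norm_complete l2_fields (hnorm linf l2_fields)"
  unfolding norm_complete_def
proof (intro allI impI)
  fix u :: "nat \<Rightarrow> nat \<Rightarrow> nat \<Rightarrow> complex"
  assume "range u \<subseteq> carrier l2_fields"
    and cauchy: "\<forall>\<epsilon>>0. \<exists>N. \<forall>m\<ge>N. \<forall>k\<ge>N. hnorm linf l2_fields (u m \<ominus>\<^bsub>l2_fields\<^esub> u k) < \<epsilon>"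
  then have u: "u m \<in> carrier l2_fields" for m
    by auto
  have diff: "(\<Sum>i<K. (cmod (u m n i - u k n i))\<^sup>2) \<le> (hnorm linf l2_fields (u m \<ominus>\<^bsub>l2_fields\<^esub> u k))\<^sup>2"
    for m k n K
    unfolding l2_fields_minus[OF u u] by (rule sum_le_hnorm_square[OF l2_fields_diff[OF u u]])
  have diff1: "cmod (u m n i - u k n i) \<le> hnorm linf l2_fields (u m \<ominus>\<^bsub>l2_fields\<^esub> u k)" for m k n i
  proof (rule power2_le_imp_le)
    have "(cmod (u m n i - u k n i))\<^sup>2 \<le> (\<Sum>i<Suc i. (cmod (u m n i - u k n i))\<^sup>2)"
      by (simp add: sum_nonneg)
    then show "(cmod (u m n i - u k n i))\<^sup>2 \<le> (hnorm linf l2_fields (u m \<ominus>\<^bsub>l2_fields\<^esub> u k))\<^sup>2"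
      using diff[of m n k "Suc i"] by (rule order_trans)
    show "0 \<le> hnorm linf l2_fields (u m \<ominus>\<^bsub>l2_fields\<^esub> u k)"
      unfolding l2_fields_minus[OF u u] hnorm_def
      using anorm_linf_nonneg[OF inprod_linf[OF l2_fields_diff[OF u u] l2_fields_diff[OF u u]]] by simp
  qed
  have "Cauchy (\<lambda>k. u k n i)" for n i
    unfolding Cauchy_iff using cauchy diff1 by (meson order.strict_trans1)
  then have "\<exists>l. \<forall>n i. (\<lambda>k. u k n i) \<longlonglongrightarrow> l n i"
    by (intro choice allI) (simp add: Cauchy_convergent_iff convergent_def)
  then obtain l where l: "\<And>n i. (\<lambda>k. u k n i) \<longlonglongrightarrow> l n i"
    by blast
  have uniform: "\<exists>N. \<forall>m\<ge>N. \<forall>n K. (\<Sum>i<K. (cmod (u m n i - l n i))\<^sup>2) \<le> \<epsilon>\<^sup>2" if \<epsilon>: "0 < \<epsilon>" for \<epsilon>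
  proof -
    obtain N where N: "\<And>m k. N \<le> m \<Longrightarrow> N \<le> k \<Longrightarrow> hnorm linf l2_fields (u m \<ominus>\<^bsub>l2_fields\<^esub> u k) < \<epsilon>"
      using cauchy \<epsilon> by blast
    have "(\<Sum>i<K. (cmod (u m n i - l n i))\<^sup>2) \<le> \<epsilon>\<^sup>2" if m: "N \<le> m" for m n K
    proof (rule LIMSEQ_le_const2)
      show "(\<lambda>k. \<Sum>i<K. (cmod (u m n i - u k n i))\<^sup>2) \<longlonglongrightarrow> (\<Sum>i<K. (cmod (u m n i - l n i))\<^sup>2)"
        by (intro tendsto_intros l)
      have "(\<Sum>i<K. (cmod (u m n i - u k n i))\<^sup>2) \<le> \<epsilon>\<^sup>2" if k: "N \<le> k" for k
      proof (rule order_trans[OF diff])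
        show "(hnorm linf l2_fields (u m \<ominus>\<^bsub>l2_fields\<^esub> u k))\<^sup>2 \<le> \<epsilon>\<^sup>2"
          using N[OF m k] order_trans[OF norm_ge_zero diff1] by (intro power_mono) auto
      qed
      then show "\<exists>N. \<forall>k\<ge>N. (\<Sum>i<K. (cmod (u m n i - u k n i))\<^sup>2) \<le> \<epsilon>\<^sup>2"
        by blast
    qed
    then show ?thesis
      by blast
  qed
  obtain N where "\<And>n K. (\<Sum>i<K. (cmod (u N n i - l n i))\<^sup>2) \<le> 1"
    using uniform[of 1] by auto
  then have "(\<lambda>n i. u N n i - l n i) \<in> carrier l2_fields"
    by (rule l2_fieldsI)
  from l2_fields_diff[OF u[of N] this] have lc: "l \<in> carrier l2_fields"
    by simp
  have "(\<lambda>m. hnorm linf l2_fields (u m \<ominus>\<^bsub>l2_fields\<^esub> l)) \<longlonglongrightarrow> 0"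
  proof (rule LIMSEQ_I)
    fix \<epsilon> :: real assume \<epsilon>: "0 < \<epsilon>"
    then obtain N where N: "\<And>m n K. N \<le> m \<Longrightarrow> (\<Sum>i<K. (cmod (u m n i - l n i))\<^sup>2) \<le> (\<epsilon> / 2)\<^sup>2"
      using uniform[of "\<epsilon> / 2"] by auto
    have "norm (hnorm linf l2_fields (u m \<ominus>\<^bsub>l2_fields\<^esub> l) - 0) < \<epsilon>" if "N \<le> m" for m
    proof -
      have "hnorm linf l2_fields (u m \<ominus>\<^bsub>l2_fields\<^esub> l) \<le> \<epsilon> / 2"
        unfolding l2_fields_minus[OF u lc] using N[OF that] \<epsilon> by (intro hnorm_le) auto
      moreover have "0 \<le> hnorm linf l2_fields (u m \<ominus>\<^bsub>l2_fields\<^esub> l)"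
        unfolding l2_fields_minus[OF u lc] hnorm_def
        using anorm_linf_nonneg[OF inprod_linf[OF l2_fields_diff[OF u lc] l2_fields_diff[OF u lc]]] by simp
      ultimately show ?thesis
        using \<epsilon> by simp
    qed
    then show "\<exists>N. \<forall>m\<ge>N. norm (hnorm linf l2_fields (u m \<ominus>\<^bsub>l2_fields\<^esub> l) - 0) < \<epsilon>"
      by blast
  qed
  with lc show "\<exists>l\<in>carrier l2_fields. (\<lambda>m. hnorm linf l2_fields (u m \<ominus>\<^bsub>l2_fields\<^esub> l)) \<longlonglongrightarrow> 0"
    by blast
qed

lemma l2_fields_hilbert_module: "hilbert_module linf l2_fields"
proof (intro hilbert_module.intro hilbert_module_axioms.intro)
  show "unital_cstar_algebra linf"
    by (rule linf_unital_cstar_algebra)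
  show "Module.module complex_field l2_fields"
    by (rule moduleI)
      (auto simp: cring_complex_field l2_fields_abelian_group l2_fields_smult algebra_simps)
  show "norm_complete l2_fields (hnorm linf l2_fields)"
    by (rule norm_complete_l2_fields)
next
  fix x assume x: "x \<in> carrier l2_fields"
  show "positive linf (inprod l2_fields x x)"
  proof (rule positive_linfI)
    show "inprod l2_fields x x \<in> carrier linf"
      using inprod_linf[OF x x] by simp
    show "inprod l2_fields x x n \<in> \<real>\<^sub>\<ge>\<^sub>0" for n
      using inprod_self[OF x, of n] suminf_nonneg[OF norm_square_summable[OF x, of n]] by simp
  qed
  show "ract l2_fields x f \<in> carrier l2_fields" if "f \<in> carrier linf" for f
    using l2_fields_ract[OF x that] by simp
  show "x = \<zero>\<^bsub>l2_fields\<^esub>" if "inprod l2_fields x x = \<zero>\<^bsub>linf\<^esub>"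
  proof -
    have "(\<Sum>i. (cmod (x n i))\<^sup>2) = 0" for n
      using fun_cong[OF that, of n] inprod_self[OF x, of n] by simp
    then have "x n i = 0" for n i
      using suminf_eq_zero_iff[OF norm_square_summable[OF x, of n]] by simp
    then show ?thesis
      by (simp add: fun_eq_iff)
  qed
  fix y assume y: "y \<in> carrier l2_fields"
  show "inprod l2_fields x y \<in> carrier linf"
    using inprod_linf[OF x y] by simp
  show "star linf (inprod l2_fields x y) = inprod l2_fields y x"
  proof -
    have "cnj (\<Sum>i. cnj (x n i) * y n i) = (\<Sum>i. cnj (cnj (x n i) * y n i))" for n
      by (rule bounded_linear.suminf[OF bounded_linear_cnj inprod_summable[OF x y]])
    then show ?thesis
      by (simp add: mult.commute)
  qed
  show "inprod l2_fields x (c \<odot>\<^bsub>l2_fields\<^esub> y) = c \<odot>\<^bsub>linf\<^esub> inprod l2_fields x y" for c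
    using suminf_mult[OF inprod_summable[OF x y], of c] by (simp add: algebra_simps)
  show "inprod l2_fields x (ract l2_fields y f) = inprod l2_fields x y \<otimes>\<^bsub>linf\<^esub> f" for f
    using suminf_mult2[OF inprod_summable[OF x y]] by (simp add: algebra_simps)
  fix z assume z: "z \<in> carrier l2_fields"
  show "inprod l2_fields x (y \<oplus>\<^bsub>l2_fields\<^esub> z) = inprod l2_fields x y \<oplus>\<^bsub>linf\<^esub> inprod l2_fields x z"
    using suminf_add[OF inprod_summable[OF x y] inprod_summable[OF x z]] by (simp add: algebra_simps)
qed (auto simp: algebra_simps)

definition unit_field :: "nat \<Rightarrow> nat \<Rightarrow> nat \<Rightarrow> complex" where
  "unit_field j = (\<lambda>n i. if i = j then 1 else 0)"

definition diagonal_field :: "nat \<Rightarrow> nat \<Rightarrow> complex" where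
  "diagonal_field = (\<lambda>n i. if i = n then 1 else 0)"

lemma sum_indicator_le: "(\<Sum>i<N. (cmod (if i = (j::nat) then 1 else 0))\<^sup>2) \<le> 1"
  by (simp add: if_distrib[of cmod] if_distrib[of "\<lambda>t. t\<^sup>2"] cong: if_cong)

lemma unit_field_closed: "unit_field j \<in> carrier l2_fields"
  unfolding unit_field_def by (rule l2_fieldsI sum_indicator_le)+

lemma diagonal_field_closed: "diagonal_field \<in> carrier l2_fields"
  unfolding diagonal_field_def by (rule l2_fieldsI sum_indicator_le)+

lemma inprod_unit_field: "inprod l2_fields (unit_field j) x = (\<lambda>n. x n j)"
proof
  fix n
  have "(\<Sum>i. cnj (unit_field j n i) * x n i) = (\<Sum>i\<in>{j}. cnj (unit_field j n i) * x n i)"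
    by (rule suminf_finite) (auto simp: unit_field_def)
  then show "inprod l2_fields (unit_field j) x n = x n j"
    by (simp add: unit_field_def)
qed

lemma unit_fields_orthonormal: "orthonormal_system linf l2_fields UNIV unit_field"
  unfolding orthonormal_system_def inprod_unit_field
  by (auto simp: unit_field_closed) (auto simp: unit_field_def)

text \<open>
  The inner products with the system are all the coordinates.
\<close>
lemma unit_fields_c4: "cond_c4 linf l2_fields UNIV unit_field"
  unfolding cond_c4_def inprod_unit_field by (auto simp: fun_eq_iff)

lemma unit_fields_combination:
  assumes "finite F" "\<And>j. j \<in> F \<Longrightarrow> a j \<in> carrier linf" "i \<notin> F"
  shows "finsum l2_fields (\<lambda>j. ract l2_fields (unit_field j) (a j)) F n i = 0"
proof -
  interpret abelian_group l2_fields
    by (rule l2_fields_abelian_group)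
  have closed: "ract l2_fields (unit_field j) f \<in> carrier l2_fields" if "f \<in> carrier linf" for j f
    using l2_fields_ract[OF unit_field_closed that] by simp
  show ?thesis
    using assms
  proof (induction F)
    case (insert k F)
    have "finsum l2_fields (\<lambda>j. ract l2_fields (unit_field j) (a j)) (insert k F)
        = ract l2_fields (unit_field k) (a k)
          \<oplus>\<^bsub>l2_fields\<^esub> finsum l2_fields (\<lambda>j. ract l2_fields (unit_field j) (a j)) F"
      using insert closed by (intro finsum_insert) auto
    then show ?case
      using insert by (simp add: unit_field_def)
  qed simp
qed

text \<open>
  A combination \<open>y\<close> over a finite set \<open>F\<close> has no \<open>n\<close>-th coordinate for \<open>n \<notin> F\<close>, so at such a point \<open>n\<close>
  it has distance at least \<open>1\<close> from the \<open>n\<close>-th basis vector, which is the value of the diagonal field.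
\<close>
lemma unit_fields_not_c1: "\<not> cond_c1 linf l2_fields UNIV unit_field"
proof
  interpret hilbert_module linf l2_fields
    by (rule l2_fields_hilbert_module)
  assume "cond_c1 linf l2_fields UNIV unit_field"
  then have "carrier l2_fields
      = norm_closure l2_fields (hnorm linf l2_fields) (A_span linf l2_fields UNIV unit_field)"
    by (simp only: cond_c1_def)
  then have "diagonal_field
      \<in> norm_closure l2_fields (hnorm linf l2_fields) (A_span linf l2_fields UNIV unit_field)"
    using diagonal_field_closed by blast
  then obtain y where "y \<in> A_span linf l2_fields UNIV unit_field"
    and y: "hnorm linf l2_fields (diagonal_field \<ominus>\<^bsub>l2_fields\<^esub> y) < 1"
    unfolding norm_closure_def using zero_less_one by blast
  then obtain F a where F: "finite F" and a: "a \<in> UNIV \<rightarrow> carrier linf"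
    and y_eq: "y = finsum l2_fields (\<lambda>j. ract l2_fields (unit_field j) (a j)) F"
    unfolding A_span_def by blast
  obtain n where n: "n \<notin> F"
    using F ex_new_if_finite infinite_UNIV_nat by blast
  have yc: "y \<in> carrier l2_fields"
    unfolding y_eq using a unit_field_closed by (intro V.finsum_closed) (auto simp del: l2_fields_simps)
  have "y n n = 0"
    unfolding y_eq using F a n by (intro unit_fields_combination) auto
  then have "1 = (cmod (diagonal_field n n - y n n))\<^sup>2"
    by (simp add: diagonal_field_def)
  also have "\<dots> \<le> (\<Sum>i<Suc n. (cmod (diagonal_field n i - y n i))\<^sup>2)"
    by (simp add: sum_nonneg)
  also have "\<dots> \<le> (hnorm linf l2_fields (diagonal_field \<ominus>\<^bsub>l2_fields\<^esub> y))\<^sup>2"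
    unfolding l2_fields_minus[OF diagonal_field_closed yc]
    by (rule sum_le_hnorm_square[OF l2_fields_diff[OF diagonal_field_closed yc]])
  also have "\<dots> < 1\<^sup>2"
    using y hnorm_nonneg[of "diagonal_field \<ominus>\<^bsub>l2_fields\<^esub> y"] diagonal_field_closed yc
    by (intro power_strict_mono) auto
  finally show False
    by simp
qed

section \<open>Comparison of the four conditions\<close>

theorem theorem2p10:
  shows "(\<forall>(A :: 'a star_algebra) (M :: ('m, 'a) inner_module) (I :: 'i set) e.
            hilbert_module A M \<and> orthonormal_system A M I e \<longrightarrow>
              (cond_c1 A M I e \<longleftrightarrow> cond_c2 A M I e) \<and>
              (cond_c2 A M I e \<longleftrightarrow> cond_c3 A M I e) \<and>
              (cond_c1 A M I e \<longrightarrow> cond_c4 A M I e) \<and>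
              (cond_c2 A M I e \<longrightarrow> cond_c4 A M I e) \<and>
              (cond_c3 A M I e \<longrightarrow> cond_c4 A M I e)) \<and>
         (\<exists>(A :: (nat \<Rightarrow> complex) star_algebra)
            (M :: (nat \<Rightarrow> nat \<Rightarrow> complex, nat \<Rightarrow> complex) inner_module)
            (I :: nat set) e.
            hilbert_module A M \<and> orthonormal_system A M I e \<and>
            cond_c4 A M I e \<and>
            \<not> cond_c1 A M I e \<and> \<not> cond_c2 A M I e \<and> \<not> cond_c3 A M I e)"
proof (intro conjI allI impI)
  fix A :: "'a star_algebra" and M :: "('m, 'a) inner_module" and I :: "'i set" and e
  assume *: "hilbert_module A M \<and> orthonormal_system A M I e"
  then interpret hilbert_module A M
    by simp
  have e: "orthonormal_system A M I e"
    using * by simp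
  show "cond_c1 A M I e \<longleftrightarrow> cond_c2 A M I e" "cond_c2 A M I e \<longleftrightarrow> cond_c3 A M I e"
    using c1_iff_c2[OF e] c2_iff_c3[OF e] .
  then show "cond_c4 A M I e" if "cond_c1 A M I e"
    using c3_imp_c4[OF e] that by blast
  show "cond_c4 A M I e" if "cond_c2 A M I e"
    using c2_iff_c3[OF e] c3_imp_c4[OF e] that by blast
  show "cond_c4 A M I e" if "cond_c3 A M I e"
    using c3_imp_c4[OF e that] .
next
  interpret hilbert_module linf l2_fields
    by (rule l2_fields_hilbert_module)
  have "\<not> cond_c2 linf l2_fields UNIV unit_field" "\<not> cond_c3 linf l2_fields UNIV unit_field"
    using unit_fields_not_c1 c1_iff_c2[OF unit_fields_orthonormal]
      c2_iff_c3[OF unit_fields_orthonormal] by blast+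
  then show "\<exists>(A :: (nat \<Rightarrow> complex) star_algebra)
      (M :: (nat \<Rightarrow> nat \<Rightarrow> complex, nat \<Rightarrow> complex) inner_module) (I :: nat set) e.
      hilbert_module A M \<and> orthonormal_system A M I e \<and> cond_c4 A M I e \<and>
      \<not> cond_c1 A M I e \<and> \<not> cond_c2 A M I e \<and> \<not> cond_c3 A M I e"
    using l2_fields_hilbert_module unit_fields_orthonormal unit_fields_c4 unit_fields_not_c1 by blast
qed

end
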